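(* Let $\Gamma$ be a connected $\mathbb{Z}^d$-periodic graph. Then there is a proper algebraic subset $S\subsetneq \mathbb{C}^{V,E}$ of the space of labelings such that for every fixed $(v,e)\in\mathbb{C}^{V,E}\setminus S$, the dispersion polynomial $D(v,e,z,\lambda)$ has no linear factor in $\lambda$, i.e. there is no $\lambda_0\in\mathbb{C}$ such that $\lambda-\lambda_0$ divides $D(v,e,z,\lambda)$ in $\mathbb{C}[z_1^{\pm1},\dots,z_d^{\pm1},\lambda]$ (equivalently, the corresponding periodic graph operator has no flat bands).
   Context: Let $d\ge 1$. A $\mathbb{Z}^d$-periodic graph is a nonempty undirected graph $\Gamma=(\mathcal V(\Gamma),\mathcal E(\Gamma))$ without self-loops $(u,u)$ and without multiple edges, with a free action of $\mathbb{Z}^d$ on the vertices, written $u\mapsto u+a$ (no nonzero $a$ fixes a vertex), preserving edges ($(u,v)\in\mathcal E(\Gamma)$ implies $(u+a,v+a)\in\mathcal E(\Gamma)$), and with finitely many orbits of vertices and of edges. A fundamental domain $W$ is a set of vertices containing exactly one vertex of each orbit; $n=|W|$ and $W$ is identified with $[n]=\{1,\dots,n\}$. A labeling $(V,E)$ of $\Gamma$ consists of a potential $V:\mathcal V(\Gamma)\to\mathbb{C}$ with $V(u+a)=V(u)$ and an edge labeling $E:\mathcal E(\Gamma)\to\mathbb{C}$ with $E((u,v))=E((v,u))=E((u+a,v+a))$ for all $a\in\mathbb{Z}^d$. $\mathbb{C}^{V,E}$ is the finite-dimensional complex affine space of all labelings; its coordinates are $v_i=V(i)$ for $i\in[n]$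 and $e_{(i,j),a}=E((i,j+a))$ for the edges $(i,j+a)\in\mathcal E(\Gamma)$, subject only to the identification $e_{(i,j),a}=e_{(j,i),-a}$; put $e_{(i,j),a}=0$ if $(i,j+a)$ is not an edge. The associated operator on functions on $\mathcal V(\Gamma)$ is $f\mapsto V(u)f(u)+\sum_{v:(u,v)\in\mathcal E(\Gamma)}E((u,v))f(v)$. The Floquet matrix is the $n\times n$ matrix $L(z)=L(v,e,z)$ with $L(z)_{i,j}=\delta_{i,j}v_i+\sum_{a\in\mathbb{Z}^d}e_{(i,j),a}z^a$, $z=(z_1,\dots,z_d)$, and the dispersion polynomial is $D(z,\lambda)=D(v,e,z,\lambda)=\det(L(z)-\lambda I)$. The operator is said to have a flat band if $\lambda-\lambda_0$ divides $D(z,\lambda)$ for some constant $\lambda_0\in\mathbb{C}$. *)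

theory Defs
  imports
    "HOL-Analysis.Finite_Cartesian_Product"
    "HOL-Library.Poly_Mapping"
    "Graph_Theory.Graph_Theory"
    "Jordan_Normal_Form.Determinant"
begin

text \<open>
  Undirected graphs without loops and multiple edges, possibly infinite, are the symmetric
  loop-free pair digraphs of \<^locale>\<open>pair_bidirected_digraph\<close>: an undirected edge is
  present as both arcs \<open>(u, v)\<close> and \<open>(v, u)\<close>. The group acting is \<open>int ^ 'd\<close>, so that
  \<open>d = CARD('d)\<close> is at least 1, and \<open>shift u a\<close> is the vertex \<open>u + a\<close>.
  There are finitely many orbits of arcs iff there are finitely many orbits of undirected edges.
\<close>

locale periodic_graph = pair_bidirected_digraph G
  for G :: "'v pair_pre_digraph" +
  fixes shift :: "'v \<Rightarrow> int ^ 'd \<Rightarrow> 'v"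
  assumes nonempty: "pverts G \<noteq> {}"
    and shift_in_verts: "u \<in> pverts G \<Longrightarrow> shift u a \<in> pverts G"
    and shift_zero: "u \<in> pverts G \<Longrightarrow> shift u 0 = u"
    and shift_add: "u \<in> pverts G \<Longrightarrow> shift u (a + b) = shift (shift u a) b"
    and shift_free: "u \<in> pverts G \<Longrightarrow> shift u a = u \<Longrightarrow> a = 0"
    and shift_arcs: "(u, v) \<in> parcs G \<Longrightarrow> (shift u a, shift v a) \<in> parcs G"
    and finite_vertex_orbits: "finite ((\<lambda>u. range (shift u)) ` pverts G)"
    and finite_arc_orbits:
      "finite ((\<lambda>(u, v). range (\<lambda>a. (shift u a, shift v a))) ` parcs G)"

definition fundamental_domain ::
    "'v pair_pre_digraph \<Rightarrow> ('v \<Rightarrow> int ^ 'd \<Rightarrow> 'v) \<Rightarrow> 'v set \<Rightarrow> bool" where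
  "fundamental_domain G shift W \<longleftrightarrow>
     W \<subseteq> pverts G \<and> (\<forall>u \<in> pverts G. \<exists>!x. x \<in> W \<and> x \<in> range (shift u))"

text \<open>
  A labeling is a pair \<open>(V, E)\<close>. As HOL functions are total, \<open>V\<close> and \<open>E\<close> are normalised to be
  zero outside the vertices and arcs; this makes pairs correspond one-to-one to labelings and
  is the convention that \<open>e\<^bsub>(i,j),a\<^esub> = 0\<close> if \<open>(i, j + a)\<close> is not an edge.
\<close>

type_synonym 'v labeling = "('v \<Rightarrow> complex) \<times> ('v \<times> 'v \<Rightarrow> complex)"

definition labelings ::
    "'v pair_pre_digraph \<Rightarrow> ('v \<Rightarrow> int ^ 'd \<Rightarrow> 'v) \<Rightarrow> 'v labeling set" where
  "labelings G shift = {(V, E).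
     (\<forall>u \<in> pverts G. \<forall>a. V (shift u a) = V u) \<and>
     (\<forall>u. u \<notin> pverts G \<longrightarrow> V u = 0) \<and>
     (\<forall>u v. (u, v) \<in> parcs G \<longrightarrow> E (u, v) = E (v, u)) \<and>
     (\<forall>u v a. (u, v) \<in> parcs G \<longrightarrow> E (shift u a, shift v a) = E (u, v)) \<and>
     (\<forall>e. e \<notin> parcs G \<longrightarrow> E e = 0)}"

text \<open>
  From here on the fundamental domain is enumerated as \<open>w 0, \<dots>, w (n - 1)\<close>.
  The coordinates of a labeling are \<open>v\<^sub>i = V (w i)\<close> and
  \<open>e\<^bsub>(i,j),a\<^esub> = E (w i, w j + a)\<close>; the polynomial functions on the space of labelings
  form the algebra generated by them.
\<close>

inductive labeling_polynomial ::
    "'v pair_pre_digraph \<Rightarrow> ('v \<Rightarrow> int ^ 'd \<Rightarrow> 'v) \<Rightarrow> nat \<Rightarrow> (nat \<Rightarrow> 'v) \<Rightarrow>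
     ('v labeling \<Rightarrow> complex) \<Rightarrow> bool"
  for G shift n w where
  const: "labeling_polynomial G shift n w (\<lambda>_. c)"
| vertex_coord: "i < n \<Longrightarrow> labeling_polynomial G shift n w (\<lambda>(V, E). V (w i))"
| edge_coord: "i < n \<Longrightarrow> j < n \<Longrightarrow> (w i, shift (w j) a) \<in> parcs G \<Longrightarrow>
    labeling_polynomial G shift n w (\<lambda>(V, E). E (w i, shift (w j) a))"
| add: "labeling_polynomial G shift n w p \<Longrightarrow> labeling_polynomial G shift n w q \<Longrightarrow>
    labeling_polynomial G shift n w (\<lambda>x. p x + q x)"
| mult: "labeling_polynomial G shift n w p \<Longrightarrow> labeling_polynomial G shift n w q \<Longrightarrow>
    labeling_polynomial G shift n w (\<lambda>x. p x * q x)"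

definition algebraic_subset ::
    "'v pair_pre_digraph \<Rightarrow> ('v \<Rightarrow> int ^ 'd \<Rightarrow> 'v) \<Rightarrow> nat \<Rightarrow> (nat \<Rightarrow> 'v) \<Rightarrow>
     'v labeling set \<Rightarrow> bool" where
  "algebraic_subset G shift n w S \<longleftrightarrow>
     (\<exists>P. (\<forall>p \<in> P. labeling_polynomial G shift n w p) \<and>
          S = {x \<in> labelings G shift. \<forall>p \<in> P. p x = 0})"

text \<open>
  The Laurent polynomial ring in \<open>z\<^sub>1, \<dots>, z\<^sub>d\<close> over the complex numbers is the group algebra
  of \<open>int ^ 'd\<close>, with \<open>c z\<^sup>a\<close> represented by \<^term>\<open>Poly_Mapping.single a c\<close>.
\<close>

type_synonym 'd laurent = "(int ^ 'd) \<Rightarrow>\<^sub>0 complex"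

definition laurent_const :: "complex \<Rightarrow> 'd::finite laurent" where
  "laurent_const c = Poly_Mapping.single 0 c"

definition floquet_matrix ::
    "'v pair_pre_digraph \<Rightarrow> ('v \<Rightarrow> int ^ 'd \<Rightarrow> 'v) \<Rightarrow> nat \<Rightarrow> (nat \<Rightarrow> 'v) \<Rightarrow>
     'v labeling \<Rightarrow> 'd::finite laurent mat" where
  "floquet_matrix G shift n w = (\<lambda>(V, E).
     mat n n (\<lambda>(i, j). (if i = j then laurent_const (V (w i)) else 0) +
       (\<Sum>a \<in> {a. (w i, shift (w j) a) \<in> parcs G}.
          Poly_Mapping.single a (E (w i, shift (w j) a)))))"

text \<open>The sum in the Floquet matrix is finite, so it is not subject to the convention that
  sums over infinite sets vanish.\<close>

lemma (in periodic_graph) finite_floquet_support: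
  assumes v: "v \<in> pverts G"
  shows "finite {a. (u, shift v a) \<in> parcs G}"
proof -
  let ?o = "\<lambda>(u, v). range (\<lambda>a. (shift u a, shift v a))"
  have "inj_on (\<lambda>a. ?o (u, shift v a)) {a. (u, shift v a) \<in> parcs G}"
  proof (rule inj_onI)
    fix a b
    assume "a \<in> {a. (u, shift v a) \<in> parcs G}" "b \<in> {a. (u, shift v a) \<in> parcs G}"
      and eq: "?o (u, shift v a) = ?o (u, shift v b)"
    then have u: "u \<in> pverts G" and va: "shift v a \<in> pverts G" and vb: "shift v b \<in> pverts G"
      using arc_fst_in_verts arc_snd_in_verts by fastforce+
    have "(u, shift v a) \<in> ?o (u, shift v a)"
      using shift_zero[OF u] shift_zero[OF va] by (auto intro!: image_eqI[of _ _ 0])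
    then obtain c where "u = shift u c" "shift v a = shift (shift v b) c"
      unfolding eq by auto
    with shift_free[OF u] shift_zero[OF vb] have *: "shift v a = shift v b" by metis
    have "shift v (a - b) = shift (shift v b) (- b)"
      using * shift_add[OF v, of a "- b"] by simp
    also have "\<dots> = v"
      using shift_add[OF v, of b "- b"] shift_zero[OF v] by simp
    finally show "a = b" using shift_free[OF v] by fastforce
  qed
  moreover have "finite ((\<lambda>a. ?o (u, shift v a)) ` {a. (u, shift v a) \<in> parcs G})"
    by (rule finite_subset[OF _ finite_arc_orbits]) auto
  ultimately show ?thesis by (rule finite_imageD[rotated])
qed

definition dispersion_poly ::
    "'v pair_pre_digraph \<Rightarrow> ('v \<Rightarrow> int ^ 'd \<Rightarrow> 'v) \<Rightarrow> nat \<Rightarrow> (nat \<Rightarrow> 'v) \<Rightarrow>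
     'v labeling \<Rightarrow> 'd::finite laurent poly" where
  "dispersion_poly G shift n w x =
     det (map_mat (\<lambda>f. [:f:]) (floquet_matrix G shift n w x) - [:0, 1:] \<cdot>\<^sub>m 1\<^sub>m n)"

end

theory Submission
  imports
    Defs
    "Jordan_Normal_Form.Char_Poly"
    "HOL-Computational_Algebra.Field_as_Ring"
    "Subresultants.Subresultant_Gcd"
begin

text \<open>
  A flat band at \<open>\<lambda>\<^sub>0\<close> makes \<open>\<lambda>\<^sub>0\<close> an eigenvalue of \<open>L(z)\<close> for every \<open>z\<close>, so for fixed \<open>z\<close> and
  \<open>z'\<close> the resultant of the characteristic polynomials of \<open>L(z)\<close> and \<open>L(z')\<close> vanishes; this
  resultant is a polynomial in the labeling. It remains to find one labeling for which \<open>L(z)\<close> and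
  \<open>L(z')\<close> have disjoint spectra. A shortest walk between two distinct translates of a vertex gives
  a simple cycle of length \<open>m\<close> in the quotient graph with nonzero translation \<open>d\<close>. With zero
  potential and weight 1 on this cycle, the eigenvalue equation is
  \<open>\<phi>\<^bsub>k+1\<^esub> + \<phi>\<^bsub>k-1\<^esub> = (\<mu> + 1/\<mu>) \<phi>\<^bsub>k\<^esub>\<close>, \<open>\<phi>\<^bsub>k+m\<^esub> = z\<^sup>d \<phi>\<^bsub>k\<^esub>\<close>, which forces \<open>z\<^sup>d\<close> to be
  \<open>\<mu>\<^sup>m\<close> or \<open>\<mu>\<^sup>-\<^sup>m\<close>; so the spectra are disjoint if \<open>z\<^sup>d = 1\<close> and \<open>z'\<^sup>d \<noteq> 1\<close>. The remaining
  vertices are attached one at a time by a single edge of weight 1, and disjointness persists for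
  all but finitely many values of the new potential.
\<close>

section \<open>Disjoint spectra and pendant vertices\<close>

text \<open>Matrices are functions on an index set here, so that a vertex can be adjoined without
  renumbering; only the values of \<open>\<psi>\<close> on \<open>U\<close> matter.\<close>

definition eigenvalue_on :: "'i set \<Rightarrow> ('i \<Rightarrow> 'i \<Rightarrow> complex) \<Rightarrow> complex \<Rightarrow> bool" where
  "eigenvalue_on U M l \<longleftrightarrow>
     (\<exists>\<psi>. (\<exists>i\<in>U. \<psi> i \<noteq> 0) \<and> (\<forall>i\<in>U. (\<Sum>j\<in>U. M i j * \<psi> j) = l * \<psi> i))"

lemma eigenvalue_on_iff_char_poly:
  assumes f: "bij_betw f {..<n} U"
  shows "eigenvalue_on U M l \<longleftrightarrow> poly (char_poly (mat n n (\<lambda>(i, j). M (f i) (f j)))) l = 0"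
proof -
  let ?A = "mat n n (\<lambda>(i, j). M (f i) (f j))"
  have A: "?A \<in> carrier_mat n n" by simp
  have sum_f: "(\<Sum>j\<in>U. g j) = (\<Sum>j<n. g (f j))" for g :: "'a \<Rightarrow> complex"
    using sum.reindex_bij_betw[OF f, of g] by simp
  have mv: "(?A *\<^sub>v v) $ i = (\<Sum>j<n. M (f i) (f j) * v $ j)" if "i < n" "v \<in> carrier_vec n" for i v
    using that by (simp add: scalar_prod_def lessThan_atLeast0)
  have "eigenvalue_on U M l \<longleftrightarrow> eigenvalue ?A l"
  proof
    assume "eigenvalue_on U M l"
    then obtain \<psi> where 1: "\<exists>i\<in>U. \<psi> i \<noteq> 0" and 2: "\<forall>i\<in>U. (\<Sum>j\<in>U. M i j * \<psi> j) = l * \<psi> i"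
      unfolding eigenvalue_on_def by auto
    let ?v = "vec n (\<psi> \<circ> f)"
    from 1 f obtain i where "i < n" "\<psi> (f i) \<noteq> 0" by (force simp: bij_betw_def)
    then have "?v \<noteq> 0\<^sub>v n" by (metis comp_apply index_vec index_zero_vec(1))
    moreover have "?A *\<^sub>v ?v = l \<cdot>\<^sub>v ?v"
    proof (rule eq_vecI)
      fix i assume "i < dim_vec (l \<cdot>\<^sub>v ?v)"
      then have i: "i < n" by simp
      then have "f i \<in> U" using f by (auto simp: bij_betw_def)
      with 2 i show "(?A *\<^sub>v ?v) $ i = (l \<cdot>\<^sub>v ?v) $ i" by (subst mv) (auto simp: sum_f)
    qed simp
    ultimately show "eigenvalue ?A l" unfolding eigenvalue_def eigenvector_def
      by (intro exI[of _ ?v]) auto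
  next
    assume "eigenvalue ?A l"
    then obtain v where v: "v \<in> carrier_vec n" "v \<noteq> 0\<^sub>v n" "?A *\<^sub>v v = l \<cdot>\<^sub>v v"
      unfolding eigenvalue_def eigenvector_def by auto
    let ?g = "the_inv_into {..<n} f"
    have g: "?g (f i) = i" if "i < n" for i
      using that f by (auto simp: bij_betw_def the_inv_into_f_f)
    obtain i where i: "i < n" "v $ i \<noteq> 0" using v(1,2) by (metis carrier_vecD eq_vecI index_zero_vec)
    have "f i \<in> U" using i f by (auto simp: bij_betw_def)
    then have "\<exists>i\<in>U. v $ ?g i \<noteq> 0" using i g by (intro bexI[of _ "f i"]) auto
    moreover have "(\<Sum>j\<in>U. M i j * v $ ?g j) = l * v $ ?g i" if "i \<in> U" for i
    proof -
      from that f obtain k where k: "k < n" "i = f k" by (auto simp: bij_betw_def)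
      have "(\<Sum>j\<in>U. M i j * v $ ?g j) = (?A *\<^sub>v v) $ k"
        unfolding mv[OF k(1) v(1)] sum_f by (rule sum.cong) (auto simp: g k(2))
      then show ?thesis using v k g by simp
    qed
    ultimately show "eigenvalue_on U M l" unfolding eigenvalue_on_def
      by (intro exI[of _ "\<lambda>i. v $ ?g i"]) auto
  qed
  then show ?thesis using eigenvalue_root_char_poly[OF A] by simp
qed

lemma char_poly_matrix_delete:
  assumes "A \<in> carrier_mat n n" "q < n"
  shows "mat_delete (char_poly_matrix A) q q = char_poly_matrix (mat_delete A q q)"
  by (rule eq_matI) (use assms in \<open>auto simp: char_poly_matrix_def mat_delete_def\<close>)

lemma mult_mat_vec_index:
  assumes "A \<in> carrier_mat n n" "v \<in> carrier_vec n" "i < n"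
  shows "(A *\<^sub>v v) $ i = (\<Sum>j<n. A $$ (i, j) * v $ j)"
  using assms by (auto simp: scalar_prod_def lessThan_atLeast0 intro!: sum.cong)

text \<open>Cramer's rule: multiply \<open>(l - A) v = c e_q\<close> by the adjugate, whose entry at
  \<open>(q, q)\<close> is a principal minor. Stated without division, the identity also covers
  eigenvalues \<open>l\<close> of \<open>A\<close>.\<close>

lemma resolvent_entry:
  fixes A :: "complex mat"
  assumes A: "A \<in> carrier_mat n n" and q: "q < n" and v: "v \<in> carrier_vec n"
    and eq: "\<And>i. i < n \<Longrightarrow> l * v $ i - (A *\<^sub>v v) $ i = (if i = q then c else 0)"
  shows "poly (char_poly A) l * v $ q = c * poly (char_poly (mat_delete A q q)) l"
proof -
  \<comment> \<open>\<open>B\<close> is the scalar matrix \<open>l - A\<close>, obtained by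
    evaluating \<open>char_poly_matrix A\<close> entrywise at \<open>l\<close>.\<close>
  define B where "B = mat n n (\<lambda>ij. poly (char_poly_matrix A $$ ij) l)"
  have B: "B \<in> carrier_mat n n" by (simp add: B_def)
  have Bij: "B $$ (i, j) = (if i = j then l else 0) - A $$ (i, j)" if "i < n" "j < n" for i j
    using that A by (simp add: B_def char_poly_matrix_def)
  have C: "dim_row (char_poly_matrix A) = n" "dim_col (char_poly_matrix A) = n"
    using char_poly_matrix_closed[OF A] by auto
  have detB: "det B = poly (char_poly A) l"
    unfolding char_poly_def
    by (rule poly_det_cong[symmetric, OF B]) (use A C in \<open>auto simp: B_def\<close>)
  have del: "det (mat_delete B q q) = poly (char_poly (mat_delete A q q)) l"
    unfolding char_poly_def char_poly_matrix_delete[OF A q, symmetric]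
    by (rule poly_det_cong[symmetric, of _ "n - 1"])
      (use A q B C in \<open>auto simp: B_def mat_delete_def\<close>)
  have Bv: "(B *\<^sub>v v) $ i = (if i = q then c else 0)" if i: "i < n" for i
  proof -
    have "(B *\<^sub>v v) $ i = (\<Sum>j<n. ((if i = j then l else 0) - A $$ (i, j)) * v $ j)"
      unfolding mult_mat_vec_index[OF B v i] using i by (intro sum.cong) (auto simp: Bij)
    also have "\<dots> = l * v $ i - (\<Sum>j<n. A $$ (i, j) * v $ j)"
      using i by (simp add: left_diff_distrib sum_subtractf if_distrib[of "\<lambda>x. x * _"] cong: if_cong)
    also have "(\<Sum>j<n. A $$ (i, j) * v $ j) = (A *\<^sub>v v) $ i"
      using mult_mat_vec_index[OF A v i] by simp
    finally show ?thesis using eq[OF i] by simp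
  qed
  have "det B * v $ q = ((det B \<cdot>\<^sub>m 1\<^sub>m n) *\<^sub>v v) $ q"
    using v q by (simp add: scalar_prod_def sum.remove[of _ q])
  also have "(det B \<cdot>\<^sub>m 1\<^sub>m n) *\<^sub>v v = adj_mat B *\<^sub>v (B *\<^sub>v v)"
    using adj_mat[OF B] B v by (metis assoc_mult_mat_vec)
  also have "(adj_mat B *\<^sub>v (B *\<^sub>v v)) $ q = (\<Sum>i<n. adj_mat B $$ (q, i) * (B *\<^sub>v v) $ i)"
    by (rule mult_mat_vec_index) (use q adj_mat(1)[OF B] B v in auto)
  also have "\<dots> = (\<Sum>i<n. adj_mat B $$ (q, i) * (if i = q then c else 0))"
    by (rule sum.cong) (auto simp: Bv)
  also have "\<dots> = adj_mat B $$ (q, q) * c" using q by (simp add: if_distrib cong: if_cong)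
  also have "adj_mat B $$ (q, q) = det (mat_delete B q q)"
    using q B by (simp add: adj_mat_def cofactor_def)
  finally show ?thesis by (simp add: detB del mult.commute)
qed

text \<open>The entry of the resolvent \<open>(l - M)\<^sup>-\<^sup>1\<close> on \<open>U\<close> at \<open>(p, p)\<close> is \<open>\<eta> l / \<theta> l\<close>.\<close>

definition resolvent_polys ::
    "'i set \<Rightarrow> ('i \<Rightarrow> 'i \<Rightarrow> complex) \<Rightarrow> 'i \<Rightarrow> complex poly \<Rightarrow> complex poly \<Rightarrow> bool" where
  "resolvent_polys U M p \<theta> \<eta> \<longleftrightarrow>
     \<eta> \<noteq> 0 \<and> degree \<eta> < degree \<theta> \<and> (\<forall>l. poly \<theta> l = 0 \<longleftrightarrow> eigenvalue_on U M l) \<and>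
     (\<forall>l \<psi> c. (\<forall>i\<in>U. l * \<psi> i - (\<Sum>j\<in>U. M i j * \<psi> j) = (if i = p then c else 0)) \<longrightarrow>
       poly \<theta> l * \<psi> p = c * poly \<eta> l)"

text \<open>Take for \<open>\<theta>\<close> the characteristic polynomial of \<open>M\<close> on
  \<open>U\<close> and for \<open>\<eta>\<close> that of \<open>M\<close> on \<open>U - {p}\<close>;
  they are monic of degrees \<open>card U\<close> and \<open>card U - 1\<close>.\<close>

lemma resolvent_polys_exist:
  assumes U: "finite U" and p: "p \<in> U"
  shows "\<exists>\<theta> \<eta>. resolvent_polys U M p \<theta> \<eta>"
proof -
  obtain f where f: "bij_betw f {..<card U} U" 
    using U by (metis ex_bij_betw_nat_finite lessThan_atLeast0)
  let ?n = "card U"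
  let ?A = "mat ?n ?n (\<lambda>(i, j). M (f i) (f j))"
  from f p obtain q where q: "q < ?n" "f q = p"
    by (metis bij_betw_imp_surj_on imageE lessThan_iff)
  have A: "?A \<in> carrier_mat ?n ?n" by simp
  have D: "mat_delete ?A q q \<in> carrier_mat (?n - 1) (?n - 1)" using q by (intro mat_delete_carrier) auto
  have "resolvent_polys U M p (char_poly ?A) (char_poly (mat_delete ?A q q))"
    unfolding resolvent_polys_def
  proof (intro conjI allI impI)
    show "char_poly (mat_delete ?A q q) \<noteq> 0" using degree_monic_char_poly[OF D] by auto
    show "degree (char_poly (mat_delete ?A q q)) < degree (char_poly ?A)"
      unfolding conjunct1[OF degree_monic_char_poly[OF D]] conjunct1[OF degree_monic_char_poly[OF A]]
      using q by linarith
    show "poly (char_poly ?A) l = 0 \<longleftrightarrow> eigenvalue_on U M l" for l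
      by (rule eigenvalue_on_iff_char_poly[OF f, symmetric])
    fix l \<psi> c
    assume *: "\<forall>i\<in>U. l * \<psi> i - (\<Sum>j\<in>U. M i j * \<psi> j) = (if i = p then c else 0)"
    have "poly (char_poly ?A) l * vec ?n (\<psi> \<circ> f) $ q = c * poly (char_poly (mat_delete ?A q q)) l"
    proof (rule resolvent_entry[OF A q(1)])
      fix i assume i: "i < ?n"
      have "(\<Sum>j\<in>U. M (f i) j * \<psi> j) = (\<Sum>j<?n. M (f i) (f j) * \<psi> (f j))"
        using sum.reindex_bij_betw[OF f, of "\<lambda>j. M (f i) j * \<psi> j"] by simp
      also have "\<dots> = (?A *\<^sub>v vec ?n (\<psi> \<circ> f)) $ i"
        using i by (simp add: scalar_prod_def lessThan_atLeast0)
      finally have s: "(?A *\<^sub>v vec ?n (\<psi> \<circ> f)) $ i = (\<Sum>j\<in>U. M (f i) j * \<psi> j)" ..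
      have "f i \<in> U" "f i = p \<longleftrightarrow> i = q"
        using i q bij_betwE[OF f] bij_betw_imp_inj_on[OF f] by (auto dest: inj_onD)
      then show "l * vec ?n (\<psi> \<circ> f) $ i - (?A *\<^sub>v vec ?n (\<psi> \<circ> f)) $ i = (if i = q then c else 0)"
        unfolding s using i * by simp
    qed simp
    then show "poly (char_poly ?A) l * \<psi> p = c * poly (char_poly (mat_delete ?A q q)) l"
      using q by simp
  qed
  then show ?thesis by blast
qed

text \<open>A root of a common divisor would be a common root, so by the fundamental theorem of
  algebra every common divisor is constant.\<close>

lemma complex_poly_coprimeI:
  fixes p q :: "complex poly"
  assumes "\<And>x. poly p x = 0 \<Longrightarrow> poly q x \<noteq> 0"
  shows "coprime p q"
proof (rule coprimeI)
  fix r assume r: "r dvd p" "r dvd q"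
  have "poly r x \<noteq> 0" for x using r assms[of x] by (metis dvd_trans poly_eq_0_iff_dvd)
  then have "constant (poly r)" using fundamental_theorem_of_algebra by blast
  moreover have "r \<noteq> 0" using \<open>\<And>x. poly r x \<noteq> 0\<close> by auto
  ultimately show "is_unit r" by (simp add: constant_degree is_unit_iff_degree)
qed

section \<open>Attaching a pendant vertex\<close>

definition disjoint_spectra ::
    "'i set \<Rightarrow> ('i \<Rightarrow> 'i \<Rightarrow> complex) \<Rightarrow> ('i \<Rightarrow> 'i \<Rightarrow> complex) \<Rightarrow> bool" where
  "disjoint_spectra U M N \<longleftrightarrow> (\<forall>l. \<not> (eigenvalue_on U M l \<and> eigenvalue_on U N l))"

text \<open>Only the product of the two entries coupling \<open>p\<close> and \<open>u\<close> is
  prescribed: the entries themselves are the phases \<open>h b\<close> and \<open>h (- b)\<close>,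
  which depend on the character \<open>h\<close>.\<close>

definition pendant_extension ::
    "'i set \<Rightarrow> 'i \<Rightarrow> 'i \<Rightarrow> ('i \<Rightarrow> 'i \<Rightarrow> complex) \<Rightarrow> complex \<Rightarrow> ('i \<Rightarrow> 'i \<Rightarrow> complex) \<Rightarrow> bool" where
  "pendant_extension U p u M v M' \<longleftrightarrow>
     (\<forall>i\<in>U. \<forall>j\<in>U. M' i j = M i j) \<and> (\<forall>i\<in>U - {p}. M' i u = 0 \<and> M' u i = 0) \<and>
     M' p u * M' u p = 1 \<and> M' u u = v"

text \<open>On \<open>U\<close> an eigenvector solves
  \<open>(l - M) \<psi> = \<alpha> \<psi>(u) e_p\<close>, so the resolvent entry gives
  \<open>\<theta> \<psi>(p) = \<alpha> \<psi>(u) \<eta>\<close>; row \<open>u\<close> gives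
  \<open>(l - v) \<psi>(u) = \<beta> \<psi>(p)\<close>. Eliminate \<open>\<psi>(p)\<close> using
  \<open>\<alpha> \<beta> = 1\<close>. If \<open>\<psi>(u) = 0\<close>, then \<open>\<psi>\<close>
  restricts to an eigenvector of \<open>M\<close>.\<close>

lemma pendant_eigenvalue:
  assumes U: "finite U" and p: "p \<in> U" and u: "u \<notin> U"
    and ext: "pendant_extension U p u M v M'"
    and res: "resolvent_polys U M p \<theta> \<eta>"
    and ev: "eigenvalue_on (insert u U) M' l"
  shows "poly \<theta> l = 0 \<or> (l - v) * poly \<theta> l = poly \<eta> l"
proof -
  from ev obtain \<psi> where nz: "\<exists>i\<in>insert u U. \<psi> i \<noteq> 0"
    and e: "\<And>i. i \<in> insert u U \<Longrightarrow> (\<Sum>j\<in>insert u U. M' i j * \<psi> j) = l * \<psi> i"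
    unfolding eigenvalue_on_def by auto
  define \<alpha> where "\<alpha> = M' p u"
  define \<beta> where "\<beta> = M' u p"
  have ab: "\<alpha> * \<beta> = 1" "M' u u = v" using ext by (auto simp: pendant_extension_def \<alpha>_def \<beta>_def)
  have eU: "l * \<psi> i - (\<Sum>j\<in>U. M i j * \<psi> j) = (if i = p then \<alpha> * \<psi> u else 0)" if "i \<in> U" for i
  proof -
    have "(\<Sum>j\<in>U. M' i j * \<psi> j) = (\<Sum>j\<in>U. M i j * \<psi> j)"
      using ext that by (intro sum.cong) (auto simp: pendant_extension_def)
    then have "l * \<psi> i = M' i u * \<psi> u + (\<Sum>j\<in>U. M i j * \<psi> j)"
      using e[of i] that U u by simp
    then show ?thesis using that ext by (auto simp: pendant_extension_def \<alpha>_def)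
  qed
  have "(\<Sum>j\<in>U. M' u j * \<psi> j) = (\<Sum>j\<in>U. if j = p then \<beta> * \<psi> p else 0)"
    using ext by (intro sum.cong) (auto simp: pendant_extension_def \<beta>_def)
  then have eu: "(l - v) * \<psi> u = \<beta> * \<psi> p"
    using e[of u] U u p ab by (simp add: algebra_simps)
  have r: "poly \<theta> l * \<psi> p = \<alpha> * \<psi> u * poly \<eta> l" 
    using res eU by (simp add: resolvent_polys_def)
  show ?thesis
  proof (cases "\<psi> u = 0")
    case True
    then have "(\<Sum>j\<in>U. M i j * \<psi> j) = l * \<psi> i" if "i \<in> U" for i
      using eU[OF that] by (simp split: if_splits)
    then have "eigenvalue_on U M l"
      unfolding eigenvalue_on_def using nz True by (intro exI[of _ \<psi>]) auto
    then show ?thesis using res by (simp add: resolvent_polys_def)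
  next
    case False
    have "(l - v) * poly \<theta> l * \<psi> u = poly \<theta> l * ((l - v) * \<psi> u)" by simp
    also have "\<dots> = poly \<theta> l * (\<beta> * \<psi> p)" by (simp only: eu)
    also have "\<dots> = \<beta> * (poly \<theta> l * \<psi> p)" by (simp add: algebra_simps)
    also have "\<dots> = (\<alpha> * \<beta>) * poly \<eta> l * \<psi> u" unfolding r by (simp add: ac_simps)
    finally show ?thesis using False ab by simp
  qed
qed

text \<open>
  Attaching a pendant vertex \<open>u\<close> with potential \<open>v\<close> at \<open>p\<close>, a common eigenvalue \<open>l\<close> of the two
  extensions forces \<open>v = l - \<eta> l / \<theta> l\<close> for one of the two pairs \<open>(\<theta>, \<eta>)\<close>, where \<open>l\<close> is a root
  of a fixed nonzero polynomial.
\<close>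

lemma disjoint_spectra_pendant:
  assumes U: "finite U" and p: "p \<in> U" and u: "u \<notin> U" and disj: "disjoint_spectra U M N"
  obtains v where "\<And>M' N'. pendant_extension U p u M v M' \<Longrightarrow> pendant_extension U p u N v N' \<Longrightarrow>
    disjoint_spectra (insert u U) M' N'"
proof -
  obtain \<theta>1 \<eta>1 where 1: "resolvent_polys U M p \<theta>1 \<eta>1"
    using resolvent_polys_exist[OF U p] by blast
  obtain \<theta>2 \<eta>2 where 2: "resolvent_polys U N p \<theta>2 \<eta>2"
    using resolvent_polys_exist[OF U p] by blast
  have nc: "poly \<theta>1 l \<noteq> 0 \<or> poly \<theta>2 l \<noteq> 0" for l
    using disj 1 2 by (auto simp: disjoint_spectra_def resolvent_polys_def)
  then have cop: "coprime \<theta>1 \<theta>2" by (intro complex_poly_coprimeI) auto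
  define Q where "Q = \<theta>1 * \<eta>2 - \<theta>2 * \<eta>1"
  \<comment> \<open>Otherwise \<open>\<theta>1\<close>, being coprime to \<open>\<theta>2\<close>,
    divides the nonzero polynomial \<open>\<eta>1\<close> of smaller degree.\<close>
  have "Q \<noteq> 0"
  proof
    assume "Q = 0"
    then have "\<theta>1 * \<eta>2 = \<theta>2 * \<eta>1" by (simp add: Q_def)
    then have "\<theta>1 dvd \<theta>2 * \<eta>1" by (metis dvd_triv_left)
    then have "\<theta>1 dvd \<eta>1" using cop by (simp add: coprime_dvd_mult_right_iff)
    then show False using 1 by (metis dvd_imp_degree_le not_le resolvent_polys_def)
  qed
  moreover have "\<theta>1 \<noteq> 0" "\<theta>2 \<noteq> 0" using 1 2 by (auto simp: resolvent_polys_def)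
  ultimately have "Q * \<theta>1 * \<theta>2 \<noteq> 0" by simp
  then have fin: "finite {l. poly (Q * \<theta>1 * \<theta>2) l = 0}" by (rule poly_roots_finite)
  define R where "R = {l. poly (Q * \<theta>1 * \<theta>2) l = 0}"
  \<comment> \<open>At a root of the denominator the quotient is 0 by convention, which merely
    excludes one more value of \<open>v\<close>.\<close>
  let ?bad = "(\<lambda>l. l - poly \<eta>1 l / poly \<theta>1 l) ` R \<union> (\<lambda>l. l - poly \<eta>2 l / poly \<theta>2 l) ` R"
  have "finite ?bad" using fin by (simp add: R_def)
  then obtain v where v: "v \<notin> ?bad" using ex_new_if_finite[OF infinite_UNIV_char_0] by blast
  show ?thesis
  proof (rule that)
    fix M' N'
    assume ext: "pendant_extension U p u M v M'" "pendant_extension U p u N v N'"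
    show "disjoint_spectra (insert u U) M' N'"
      unfolding disjoint_spectra_def
    proof (intro allI notI)
      fix l assume l: "eigenvalue_on (insert u U) M' l \<and> eigenvalue_on (insert u U) N' l"
      have a: "poly \<theta>1 l = 0 \<or> (l - v) * poly \<theta>1 l = poly \<eta>1 l"
        by (rule pendant_eigenvalue[OF U p u ext(1) 1]) (use l in auto)
      have b: "poly \<theta>2 l = 0 \<or> (l - v) * poly \<theta>2 l = poly \<eta>2 l"
        by (rule pendant_eigenvalue[OF U p u ext(2) 2]) (use l in auto)
      \<comment> \<open>Where neither \<open>\<theta>1\<close> nor \<open>\<theta>2\<close>
        vanishes, both equations for \<open>l - v\<close> hold, and eliminating \<open>l - v\<close>
        gives \<open>Q = 0\<close> at \<open>l\<close>.\<close>
      have "poly (Q * \<theta>1 * \<theta>2) l = 0"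
      proof (cases "poly \<theta>1 l = 0 \<or> poly \<theta>2 l = 0")
        case False
        then have "poly \<eta>1 l = (l - v) * poly \<theta>1 l" "poly \<eta>2 l = (l - v) * poly \<theta>2 l"
          using a b by auto
        then show ?thesis by (simp add: Q_def)
      qed auto
      then have lR: "l \<in> R" by (simp add: R_def)
      \<comment> \<open>\<open>\<theta>1\<close> and \<open>\<theta>2\<close> have no common root,
        so at least one of the two equations can be solved for \<open>v\<close>.\<close>
      have "v = l - poly \<eta>1 l / poly \<theta>1 l \<or> v = l - poly \<eta>2 l / poly \<theta>2 l"
        using a b nc[of l] by (metis diff_diff_eq2 add_diff_cancel_left' nonzero_mult_div_cancel_right)
      then show False using v lR by blast
    qed
  qed
qed

section \<open>A weighting of the quotient graph with disjoint spectra\<close>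

text \<open>On \<open>int ^ 'd\<close> such an \<open>h\<close> is \<open>a \<mapsto> z^a\<close>
  for a point \<open>z\<close> with nonzero complex coordinates; characters stand for the points at
  which Laurent polynomials are evaluated.\<close>

definition multiplicative_character :: "('g::ab_group_add \<Rightarrow> complex) \<Rightarrow> bool" where
  "multiplicative_character h \<longleftrightarrow> h 0 = 1 \<and> (\<forall>a b. h (a + b) = h a * h b)"

lemma multiplicative_characterD:
  assumes "multiplicative_character h"
  shows "h 0 = 1" "h (a + b) = h a * h b" "h a * h (- a) = 1" "h a \<noteq> 0" "h a * h (b - a) = h b"
proof -
  show *: "h 0 = 1" "h (a + b) = h a * h b" for a b
    using assms by (auto simp: multiplicative_character_def)
  show "h a * h (- a) = 1" using *(2)[of a "- a"] *(1) by simp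
  then show "h a \<noteq> 0" by auto
  show "h a * h (b - a) = h b" using *(2)[of a "b - a"] by simp
qed

text \<open>The Floquet matrix at the point \<open>h\<close>, where \<open>A i j\<close> holds the
  translations of the arcs from \<open>i\<close> to the orbit of \<open>j\<close>.\<close>

definition bloch_matrix ::
    "(nat \<Rightarrow> nat \<Rightarrow> 'g set) \<Rightarrow> ('g \<Rightarrow> complex) \<Rightarrow> (nat \<Rightarrow> complex) \<Rightarrow>
     (nat \<Rightarrow> nat \<Rightarrow> 'g \<Rightarrow> complex) \<Rightarrow> nat \<Rightarrow> nat \<Rightarrow> complex" where
  "bloch_matrix A h v e i j = (if i = j then v i else 0) + (\<Sum>c\<in>A i j. e i j c * h c)"

text \<open>The identification of \<open>e_(i,j),a\<close> with \<open>e_(j,i),-a\<close>, imposed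
  on all triples; values off \<open>A i j\<close> do not enter \<open>bloch_matrix\<close>.\<close>

definition symmetric_weights :: "(nat \<Rightarrow> nat \<Rightarrow> 'g::ab_group_add \<Rightarrow> complex) \<Rightarrow> bool" where
  "symmetric_weights e \<longleftrightarrow> (\<forall>i j c. e j i (- c) = e i j c)"

text \<open>The differences \<open>\<phi>(k+1) - \<mu> \<phi>(k)\<close> form a geometric sequence
  with ratio \<open>1 / \<mu>\<close> and inherit the factor \<open>\<zeta>\<close>. If they all
  vanish, \<open>\<phi>\<close> itself is geometric with ratio \<open>\<mu>\<close>. This argument
  includes the double root case \<open>\<mu> = 1 / \<mu>\<close>.\<close>

lemma quasiperiodic_solution:
  fixes \<phi> :: "nat \<Rightarrow> complex"
  assumes rec: "\<And>k. \<phi> (k + 2) + \<phi> k = (\<mu> + 1 / \<mu>) * \<phi> (k + 1)" and mu: "\<mu> \<noteq> 0"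
    and per: "\<And>k. \<phi> (k + m) = \<zeta> * \<phi> k" and nz: "\<phi> k \<noteq> 0"
  shows "\<zeta> = \<mu> ^ m \<or> \<zeta> = 1 / \<mu> ^ m"
proof -
  define \<theta> where "\<theta> k = \<phi> (k + 1) - \<mu> * \<phi> k" for k
  have step: "\<theta> (Suc k) = \<theta> k / \<mu>" for k
  proof -
    have "\<theta> (Suc k) = (\<phi> (k + 2) + \<phi> k) - \<phi> k - \<mu> * \<phi> (k + 1)" by (simp add: \<theta>_def)
    also have "\<dots> = \<phi> (k + 1) / \<mu> - \<phi> k" unfolding rec by (simp add: distrib_right)
    also have "\<dots> = \<theta> k / \<mu>" using mu by (simp add: \<theta>_def diff_divide_distrib)
    finally show ?thesis .
  qed
  have pow: "\<theta> (k + j) = \<theta> k / \<mu> ^ j" for k j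
    by (induction j) (simp_all add: step mult.commute)
  show ?thesis
  proof (cases "\<forall>k. \<theta> k = 0")
    case True
    then have "\<phi> (Suc k) = \<mu> * \<phi> k" for k by (simp add: \<theta>_def)
    then have "\<phi> (k + j) = \<mu> ^ j * \<phi> k" for j by (induction j) simp_all
    then have "\<zeta> * \<phi> k = \<mu> ^ m * \<phi> k" using per[of k] by metis
    then show ?thesis using nz by (metis mult_right_cancel)
  next
    case False
    then obtain k where k: "\<theta> k \<noteq> 0" by blast
    have "\<theta> (k + m) = \<zeta> * \<theta> k"
      using per[of k] per[of "k + 1"] by (simp add: \<theta>_def algebra_simps)
    then have "\<zeta> * \<theta> k = 1 / \<mu> ^ m * \<theta> k" using pow[of k m] by simp
    then show ?thesis using k by (metis mult_right_cancel)
  qed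
qed

text \<open>\<open>\<mu>\<close> is a root of \<open>X^2 - l X + 1\<close>; the other root is
  \<open>l - \<mu>\<close>, and their product is 1.\<close>

lemma joukowski_surj:
  fixes l :: complex
  obtains \<mu> where "\<mu> \<noteq> 0" "l = \<mu> + 1 / \<mu>"
proof -
  define s where "s = csqrt (l\<^sup>2 - 4)"
  have s: "s * s = l * l - 4" by (simp add: s_def flip: power2_eq_square)
  define \<mu> where "\<mu> = (l + s) / 2"
  have "l - \<mu> = (l - s) / 2" by (simp add: \<mu>_def field_simps)
  then have "\<mu> * (l - \<mu>) = (l + s) * (l - s) / 4" by (simp add: \<mu>_def)
  also have "(l + s) * (l - s) = 4" using s by (simp add: algebra_simps)
  finally have eq: "\<mu> * (l - \<mu>) = 1" by simp
  then have "\<mu> \<noteq> 0" by auto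
  moreover have "1 / \<mu> = l - \<mu>"
    using eq \<open>\<mu> \<noteq> 0\<close> by (metis nonzero_mult_div_cancel_left)
  then have "l = \<mu> + 1 / \<mu>" by simp
  ultimately show ?thesis by (rule that)
qed

section \<open>A cycle with nonzero translation in the quotient graph\<close>

text \<open>The pair \<open>(i, a)\<close> stands for the vertex \<open>w i + a\<close>, and
  \<open>c\<close> in \<open>A i j\<close> for an arc from \<open>(i, a)\<close> to
  \<open>(j, a + c)\<close>; the last assumption is connectedness of the periodic graph.\<close>

locale quotient_graph =
  fixes n :: nat and A :: "nat \<Rightarrow> nat \<Rightarrow> (int ^ 'd::finite) set"
  assumes n_pos: "0 < n"
    and finite_A: "i < n \<Longrightarrow> j < n \<Longrightarrow> finite (A i j)"
    and sym_A: "i < n \<Longrightarrow> j < n \<Longrightarrow> c \<in> A i j \<Longrightarrow> - c \<in> A j i"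
    and lift_connected: "i < n \<Longrightarrow> j < n \<Longrightarrow>
      ((i, a), (j, b)) \<in> {((i, a), (j, b)). i < n \<and> j < n \<and> b - a \<in> A i j}\<^sup>*"
begin

definition lift :: "((nat \<times> (int ^ 'd)) \<times> (nat \<times> (int ^ 'd))) set" where
  "lift = {((i, a), (j, b)). i < n \<and> j < n \<and> b - a \<in> A i j}"

text \<open>
  A shortest walk joining two distinct lifts of one vertex meets no vertex orbit twice; its
  translates form a bi-infinite path, of which \<open>(I k, S k)\<close> is a parametrisation.
\<close>

lemma simple_periodic_walk:
  obtains m :: nat and d :: "int ^ 'd" and I S
  where "0 < m" "d \<noteq> 0" "\<And>k. I k < n" "\<And>k. S (Suc k) - S k \<in> A (I k) (I (Suc k))"
    "\<And>k. I (k + m) = I k" "\<And>k. S (k + m) = S k + d" "\<And>k l. I k = I l \<Longrightarrow> k mod m = l mod m"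
proof -
  define Q where "Q m \<longleftrightarrow> (\<exists>i a b. a \<noteq> b \<and> ((i, a), (i, b)) \<in> lift ^^ m)" for m
  \<comment> \<open>Here \<open>1\<close> is the vector with all entries 1; it serves as a nonzero
    translation.\<close>
  have "((0, 0), (0, 1)) \<in> lift\<^sup>*"
    unfolding lift_def using n_pos by (intro lift_connected)
  then obtain m0 where "((0, 0), (0, 1)) \<in> lift ^^ m0"
    using rtrancl_imp_relpow by blast
  moreover have "(0 :: int ^ 'd) \<noteq> 1" by (simp add: Finite_Cartesian_Product.vec_eq_iff)
  ultimately have "Q m0" unfolding Q_def by blast
  define m where "m = (LEAST m. Q m)"
  have "Q m" unfolding m_def using \<open>Q m0\<close> by (rule LeastI)
  have least: "m \<le> k" if "Q k" for k unfolding m_def using that by (rule Least_le)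
  from \<open>Q m\<close> obtain i a b where ab: "a \<noteq> b" and "((i, a), (i, b)) \<in> lift ^^ m"
    unfolding Q_def by blast
  then obtain f where f0: "f 0 = (i, a)" and fm: "f m = (i, b)"
    and f: "\<And>k. k < m \<Longrightarrow> (f k, f (Suc k)) \<in> lift"
    unfolding relpow_fun_conv by blast
  have m: "0 < m" using ab f0 fm by (metis Pair_inject gr0I)
  have sub: "(f k, f l) \<in> lift ^^ (l - k)" if "k \<le> l" "l \<le> m" for k l
    unfolding relpow_fun_conv
    using that f by (intro exI[of _ "\<lambda>j. f (k + j)"]) auto
  \<comment> \<open>If the walk meets the same lift twice, cutting out the closed piece leaves a
    shorter walk with the same ends; if it meets two different lifts of one vertex, the piece
    between them is a shorter walk of the required kind.\<close>
  have no_repeat: False if kl: "k < l" "l < m" and eq: "fst (f k) = fst (f l)" for k l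
  proof (cases "snd (f k) = snd (f l)")
    case True
    then have "f k = f l" using eq by (simp add: prod_eq_iff)
    then have "(f 0, f m) \<in> lift ^^ (k - 0) O lift ^^ (m - l)"
      using sub[of 0 k] sub[of l m] kl by auto
    then have "(f 0, f m) \<in> lift ^^ (k + (m - l))" by (simp add: relpow_add)
    then have "Q (k + (m - l))" unfolding Q_def using ab f0 fm by auto
    then show False using least kl by fastforce
  next
    case False
    have "((fst (f k), snd (f k)), (fst (f k), snd (f l))) \<in> lift ^^ (l - k)"
      using sub[of k l] kl eq by (metis less_imp_le prod.collapse)
    then have "Q (l - k)" unfolding Q_def using False by blast
    then show False using least kl by fastforce
  qed
  define d where "d = b - a"
  \<comment> \<open>Each block of \<open>m\<close> steps runs through the walk once, translated by
    one more multiple of \<open>d\<close>.\<close>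
  define I where "I k = fst (f (k mod m))" for k
  define S where "S k = snd (f (k mod m)) + int (k div m) *s d" for k
  show ?thesis
  proof (rule that[of m d I S])
    show "0 < m" by (rule m)
    show "d \<noteq> 0" using ab by (simp add: d_def)
    have step: "(f (k mod m), f (Suc (k mod m))) \<in> lift" for k
      using m by (intro f) simp
    show "I k < n" for k
      using step[of k] by (auto simp: I_def lift_def)
    show "S (Suc k) - S k \<in> A (I k) (I (Suc k))" for k
    \<comment> \<open>At the end of a block \<open>f m = (i, b)\<close> must agree with the start
      \<open>f 0 = (i, a)\<close> of the next one; the extra summand \<open>d = b - a\<close>
      ensures this.\<close>
    proof (cases "Suc (k mod m) = m")
      case True
      then have "Suc k mod m = 0" "Suc k div m = Suc (k div m)"
        by (simp_all add: mod_Suc div_Suc)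
      moreover have "(int (Suc (k div m)) *s d) = int (k div m) *s d + d"
        by (simp add: Finite_Cartesian_Product.vec_eq_iff algebra_simps)
      ultimately show ?thesis
        using step[of k] True f0 fm by (auto simp: I_def S_def lift_def d_def split_beta)
    next
      case False
      then have "Suc k mod m = Suc (k mod m)" "Suc k div m = k div m"
        by (simp_all add: mod_Suc div_Suc)
      then show ?thesis using step[of k] by (auto simp: I_def S_def lift_def split_beta)
    qed
    show "I (k + m) = I k" for k by (simp add: I_def)
    show "S (k + m) = S k + d" for k
      using m by (simp add: S_def vector_sadd_rdistrib)
    show "k mod m = l mod m" if "I k = I l" for k l
      using that no_repeat[of "k mod m" "l mod m"] no_repeat[of "l mod m" "k mod m"] m
      unfolding I_def by (metis mod_less_divisor nat_neq_iff)
  qed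
qed

text \<open>\<open>U\<close> consists of the vertices of the cycle and \<open>e\<close> is 1 on its
  arcs in both directions, 0 elsewhere. An eigenvalue \<open>\<mu> + 1 / \<mu>\<close> ties the
  value of the character at \<open>d\<close> to \<open>\<mu>^m\<close>.\<close>

lemma cycle_weights:
  obtains U e and d :: "int ^ 'd"
  where "U \<noteq> {}" "U \<subseteq> {..<n}" "symmetric_weights e" "d \<noteq> 0"
    "\<And>g h. multiplicative_character g \<Longrightarrow> multiplicative_character h \<Longrightarrow> g d = 1 \<Longrightarrow> h d \<noteq> 1 \<Longrightarrow>
      disjoint_spectra U (bloch_matrix A g (\<lambda>_. 0) e) (bloch_matrix A h (\<lambda>_. 0) e)"
proof -
  obtain m and d :: "int ^ 'd" and I S where m: "0 < m" and d: "d \<noteq> 0" and In: "\<And>k. I k < n"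
    and step: "\<And>k. S (Suc k) - S k \<in> A (I k) (I (Suc k))"
    and perI: "\<And>k. I (k + m) = I k" and perS: "\<And>k. S (k + m) = S k + d"
    and inj: "\<And>k l. I k = I l \<Longrightarrow> k mod m = l mod m"
    by (rule simple_periodic_walk) blast
  have per: "I (k + q * m) = I k \<and> S (k + q * m) = S k + int q *s d" for k q
  proof (induction q)
    case (Suc q)
    have "k + Suc q * m = k + q * m + m" by simp
    then show ?case using perI[of "k + q * m"] perS[of "k + q * m"] Suc
      by (simp only:) (simp add: Finite_Cartesian_Product.vec_eq_iff algebra_simps)
  qed (simp add: Finite_Cartesian_Product.vec_eq_iff)
  have mod_eq: "I (Suc k) = I (Suc (k mod m)) \<and> I k = I (k mod m) \<and>
      S (Suc k) - S k = S (Suc (k mod m)) - S (k mod m)" for k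
    using per[of "k mod m" "k div m"] per[of "Suc (k mod m)" "k div m"] by simp
  have congr: "I (Suc k) = I (Suc l) \<and> I k = I l \<and> S (Suc k) - S k = S (Suc l) - S l"
    if "k mod m = l mod m" for k l
    using mod_eq[of k] mod_eq[of l] that by simp
  have S_mod: "S k = S (k mod m) + int (k div m) *s d" for k
    using per[of "k mod m" "k div m"] by simp
  \<comment> \<open>The lifted path never meets a vertex twice, because \<open>d\<close> is
    nonzero.\<close>
  have inj2: "k = l" if "I k = I l" "S k = S l" for k l
  proof -
    have eq: "k mod m = l mod m" by (rule inj[OF that(1)])
    have "S (k mod m) + int (k div m) *s d = S (k mod m) + int (l div m) *s d"
      using S_mod[of k] S_mod[of l] that(2) eq by metis
    moreover obtain r where "d $ r \<noteq> 0" using d by (auto simp: Finite_Cartesian_Product.vec_eq_iff)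
    ultimately have "k div m = l div m" by (auto simp: Finite_Cartesian_Product.vec_eq_iff)
    then show ?thesis using eq by (metis div_mult_mod_eq)
  qed
  define arc where "arc i j c \<longleftrightarrow>
    (\<exists>k. (I k = i \<and> I (Suc k) = j \<and> S (Suc k) - S k = c) \<or>
      (I (Suc k) = i \<and> I k = j \<and> S k - S (Suc k) = c))" for i j c
  define e where "e i j c = (if arc i j c then 1 else 0 :: complex)" for i j c
  have "arc j i (- c) \<longleftrightarrow> arc i j c" for i j c
    unfolding arc_def by (rule ex_cong1) (auto simp: algebra_simps)
  then have sym: "symmetric_weights e" by (simp add: symmetric_weights_def e_def)
  define U where "U = range I"
  have U: "U \<noteq> {}" "U \<subseteq> {..<n}" using In by (auto simp: U_def)
  then have finU: "finite U" using finite_subset by blast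
  have arc_iff: "arc (I (Suc k)) j c \<longleftrightarrow>
      (j, c) \<in> {(I (k + 2), S (k + 2) - S (k + 1)), (I k, S k - S (k + 1))}" for k j c
  proof
    assume "arc (I (Suc k)) j c"
    then obtain l where "(I l = I (Suc k) \<and> I (Suc l) = j \<and> S (Suc l) - S l = c) \<or>
      (I (Suc l) = I (Suc k) \<and> I l = j \<and> S l - S (Suc l) = c)"
      unfolding arc_def by blast
    then show "(j, c) \<in> {(I (k + 2), S (k + 2) - S (k + 1)), (I k, S k - S (k + 1))}"
    proof (elim disjE conjE)
      assume *: "I l = I (Suc k)" "I (Suc l) = j" "S (Suc l) - S l = c"
      show ?thesis using congr[OF inj[OF *(1)]] * by simp
    next
      assume *: "I (Suc l) = I (Suc k)" "I l = j" "S l - S (Suc l) = c"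
      \<comment> \<open>Adding \<open>m - 1\<close> undoes the successor modulo
        \<open>m\<close>.\<close>
      have "l mod m = k mod m"
        using mod_add_cong[OF inj[OF *(1)] refl, of "m - 1"] m by simp
      from congr[OF this] * have "I k = j" "S k - S (Suc k) = c" by (auto simp: algebra_simps)
      then show ?thesis by simp
    qed
  qed (auto simp: arc_def)
  have row: "(\<Sum>j\<in>U. bloch_matrix A h (\<lambda>_. 0) e (I (Suc k)) j * \<psi> j) =
      h (S (k + 2) - S (k + 1)) * \<psi> (I (k + 2)) + h (S k - S (k + 1)) * \<psi> (I k)" for h \<psi> k
  proof -
    define N where "N = {(I (k + 2), S (k + 2) - S (k + 1)), (I k, S k - S (k + 1))}"
    have e_row: "e (I (Suc k)) j c = (if (j, c) \<in> N then 1 else 0)" for j c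
      unfolding e_def N_def arc_iff ..
    \<comment> \<open>The forward and backward arcs differ even for \<open>m = 1\<close> or
      \<open>m = 2\<close>, where the neighbours coincide in the quotient; hence the row sum has
      exactly two terms.\<close>
    have ne: "(I (k + 2), S (k + 2) - S (k + 1)) \<noteq> (I k, S k - S (k + 1))"
      using inj2[of "k + 2" k] by auto
    have "- (S (Suc k) - S k) \<in> A (I (Suc k)) (I k)" by (intro sym_A step In)
    then have sub: "N \<subseteq> Sigma U (A (I (Suc k)))"
      using step[of "Suc k"] by (auto simp: U_def N_def)
    have finA: "finite (A (I (Suc k)) j)" if "j \<in> U" for j
      using that U In by (intro finite_A) auto
    have "(\<Sum>j\<in>U. bloch_matrix A h (\<lambda>_. 0) e (I (Suc k)) j * \<psi> j) =
        (\<Sum>j\<in>U. \<Sum>c\<in>A (I (Suc k)) j. e (I (Suc k)) j c * h c * \<psi> j)"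
      by (simp add: bloch_matrix_def sum_distrib_right)
    also have "\<dots> = (\<Sum>(j, c)\<in>Sigma U (A (I (Suc k))). e (I (Suc k)) j c * h c * \<psi> j)"
      using finU finA by (intro sum.Sigma) auto
    also have "\<dots> = (\<Sum>(j, c)\<in>N. e (I (Suc k)) j c * h c * \<psi> j)"
      using finU finA sub by (intro sum.mono_neutral_right) (auto simp: e_row)
    also have "\<dots> = (\<Sum>(j, c)\<in>N. h c * \<psi> j)"
      by (intro sum.cong refl) (auto simp: e_row)
    also have "\<dots> = h (S (k + 2) - S (k + 1)) * \<psi> (I (k + 2)) + h (S k - S (k + 1)) * \<psi> (I k)"
      using ne by (simp add: N_def)
    finally show ?thesis .
  qed
  have mono: "h d = \<mu> ^ m \<or> h d = 1 / \<mu> ^ m"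
    if h: "multiplicative_character h" and ev: "eigenvalue_on U (bloch_matrix A h (\<lambda>_. 0) e) (\<mu> + 1 / \<mu>)"
      and mu: "\<mu> \<noteq> 0" for h \<mu>
  proof -
    note hD = multiplicative_characterD[OF h]
    from ev obtain \<psi> where nz: "\<exists>i\<in>U. \<psi> i \<noteq> 0"
      and eq: "\<And>i. i \<in> U \<Longrightarrow> (\<Sum>j\<in>U. bloch_matrix A h (\<lambda>_. 0) e i j * \<psi> j) = (\<mu> + 1 / \<mu>) * \<psi> i"
      unfolding eigenvalue_on_def by blast
    from nz obtain k0 where k0: "\<psi> (I k0) \<noteq> 0" by (auto simp: U_def)
    \<comment> \<open>The Bloch wave: \<open>\<psi>\<close> extended quasiperiodically along the
      lifted path, which turns the row equations into a recursion with constant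
      coefficients.\<close>
    define \<phi> where "\<phi> k = h (S k) * \<psi> (I k)" for k
    show ?thesis
    proof (rule quasiperiodic_solution[of \<phi> \<mu> m "h d" k0])
      show "\<phi> (k + 2) + \<phi> k = (\<mu> + 1 / \<mu>) * \<phi> (k + 1)" for k
      proof -
        have "\<phi> (k + 2) + \<phi> k = h (S (k + 1)) *
            (h (S (k + 2) - S (k + 1)) * \<psi> (I (k + 2)) + h (S k - S (k + 1)) * \<psi> (I k))"
          unfolding \<phi>_def distrib_left mult.assoc[symmetric] hD(5) ..
        also have "\<dots> = h (S (k + 1)) * ((\<mu> + 1 / \<mu>) * \<psi> (I (k + 1)))"
          using eq[of "I (Suc k)"] row[of h k \<psi>] by (simp add: U_def)
        also have "\<dots> = (\<mu> + 1 / \<mu>) * \<phi> (k + 1)" by (simp add: \<phi>_def)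
        finally show ?thesis .
      qed
      show "\<phi> (k + m) = h d * \<phi> k" for k
        by (simp add: \<phi>_def perI perS hD(2))
      show "\<phi> k0 \<noteq> 0" using k0 hD(4) by (simp add: \<phi>_def)
    qed (rule mu)
  qed
  show ?thesis
  proof (rule that[OF U sym d])
    fix g h :: "int ^ 'd \<Rightarrow> complex"
    assume g: "multiplicative_character g" "g d = 1" and h: "multiplicative_character h" "h d \<noteq> 1"
    show "disjoint_spectra U (bloch_matrix A g (\<lambda>_. 0) e) (bloch_matrix A h (\<lambda>_. 0) e)"
      unfolding disjoint_spectra_def
    proof (intro allI notI)
      fix l
      assume l: "eigenvalue_on U (bloch_matrix A g (\<lambda>_. 0) e) l \<and>
        eigenvalue_on U (bloch_matrix A h (\<lambda>_. 0) e) l"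
      obtain \<mu> where mu: "\<mu> \<noteq> 0" "l = \<mu> + 1 / \<mu>" by (rule joukowski_surj)
      \<comment> \<open>\<open>g d = 1\<close> gives \<open>\<mu>^m = 1\<close>, and then
        \<open>h d = 1\<close>, contrary to the choice of \<open>h\<close>.\<close>
      show False
        using mono[OF g(1) _ mu(1)] mono[OF h(1) _ mu(1)] l mu g(2) h(2) by auto
    qed
  qed
qed

section \<open>From the cycle to all vertices of the quotient\<close>

text \<open>Without such an arc the lifts of \<open>U\<close> would be closed under adjacency,
  contradicting connectedness.\<close>

lemma boundary_arc:
  assumes "U \<noteq> {}" "U \<subset> {..<n}"
  obtains p u b where "p \<in> U" "u < n" "u \<notin> U" "b \<in> A p u"
proof (rule ccontr)
  assume no: "\<not> thesis"
  obtain i j where ij: "i \<in> U" "j < n" "j \<notin> U" using assms by auto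
  have "((i, 0), (j, 0)) \<in> lift\<^sup>*"
    unfolding lift_def using ij assms by (intro lift_connected) auto
  then have "fst (j, 0 :: int ^ 'd) \<in> U"
  proof (induction rule: rtrancl_induct)
    case (step y z)
    then have "fst y \<in> U" "fst z < n" "snd z - snd y \<in> A (fst y) (fst z)" by (auto simp: lift_def)
    then show ?case using no that by blast
  qed (use ij in simp)
  then show False using ij by simp
qed

text \<open>The new entries at \<open>(p, u)\<close> and \<open>(u, p)\<close> are
  \<open>h b\<close> and \<open>h (- b)\<close>, with product 1 for every character; hence a single
  choice of edge and potential serves both characters.\<close>

lemma pendant_weights:
  assumes p: "p \<in> U" "U \<subseteq> {..<n}" and u: "u < n" "u \<notin> U" and b: "b \<in> A p u"
    and h: "multiplicative_character h"
  shows "pendant_extension U p u (bloch_matrix A h v e) x (bloch_matrix A h (v(u := x))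
    (\<lambda>i j c. if i \<in> U \<and> j \<in> U then e i j c
      else if (i, j, c) = (p, u, b) \<or> (i, j, c) = (u, p, - b) then 1 else 0))"
    (is "pendant_extension _ _ _ _ _ (bloch_matrix A h _ ?e)")
proof -
  have pn: "p < n" and pu: "p \<noteq> u" using p u by auto
  have "bloch_matrix A h (v(u := x)) ?e p u = (\<Sum>c\<in>A p u. if c = b then h b else 0)"
    using pu u by (auto simp: bloch_matrix_def intro!: sum.cong)
  also have "\<dots> = h b" using b finite_A[OF pn u(1)] by simp
  finally have 1: "bloch_matrix A h (v(u := x)) ?e p u = h b" .
  have "bloch_matrix A h (v(u := x)) ?e u p = (\<Sum>c\<in>A u p. if c = - b then h (- b) else 0)"
    using pu u by (auto simp: bloch_matrix_def intro!: sum.cong)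
  also have "\<dots> = h (- b)" using sym_A[OF pn u(1) b] finite_A[OF u(1) pn] by simp
  finally have 2: "bloch_matrix A h (v(u := x)) ?e u p = h (- b)" .
  show ?thesis
    unfolding pendant_extension_def 1 2
    using u pu multiplicative_characterD(3)[OF h]
    by (auto simp: bloch_matrix_def intro!: sum.cong sum.neutral)
qed

text \<open>Induction on the number of vertices outside \<open>U\<close>, attaching one vertex along
  a boundary arc at each step.\<close>

lemma disjoint_spectra_extend:
  assumes g: "multiplicative_character g" and h: "multiplicative_character h"
    and "U \<noteq> {}" "U \<subseteq> {..<n}" "symmetric_weights e"
    and "disjoint_spectra U (bloch_matrix A g v e) (bloch_matrix A h v e)"
  shows "\<exists>v e. symmetric_weights e \<and>
    disjoint_spectra {..<n} (bloch_matrix A g v e) (bloch_matrix A h v e)"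
  using assms(3-)
proof (induction "card ({..<n} - U)" arbitrary: U v e rule: less_induct)
  case less
  show ?case
  proof (cases "U = {..<n}")
    case True
    then show ?thesis using less.prems by blast
  next
    case False
    then obtain p u b where pub: "p \<in> U" "u < n" "u \<notin> U" "b \<in> A p u"
      using boundary_arc[of U] less.prems by blast
    have fin: "finite U" using less.prems(2) finite_subset by blast
    obtain x where x: "\<And>M' N'. pendant_extension U p u (bloch_matrix A g v e) x M' \<Longrightarrow>
        pendant_extension U p u (bloch_matrix A h v e) x N' \<Longrightarrow> disjoint_spectra (insert u U) M' N'"
      by (rule disjoint_spectra_pendant[OF fin pub(1,3) less.prems(4)]) blast
    \<comment> \<open>Weights of \<open>e\<close> with an end outside \<open>U\<close> are
      discarded, so that the new edge is the only one at \<open>u\<close>.\<close>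
    define e' where "e' = (\<lambda>i j c. if i \<in> U \<and> j \<in> U then e i j c
      else if (i, j, c) = (p, u, b) \<or> (i, j, c) = (u, p, - b) then 1 else 0)"
    have "disjoint_spectra (insert u U) (bloch_matrix A g (v(u := x)) e') (bloch_matrix A h (v(u := x)) e')"
      unfolding e'_def using pub less.prems(2) g h by (intro x pendant_weights)
    moreover have "symmetric_weights e'"
      using less.prems(3) pub(1,3) unfolding symmetric_weights_def e'_def by auto
    moreover have "card ({..<n} - insert u U) < card ({..<n} - U)"
      using pub by (intro psubset_card_mono) auto
    ultimately show ?thesis
      using less.hyps[of "insert u U"] less.prems(2) pub(2) by simp
  qed
qed

lemma ex_disjoint_spectra:
  obtains g h :: "int ^ 'd \<Rightarrow> complex" and v e
  where "multiplicative_character g" "multiplicative_character h" "symmetric_weights e"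
    "disjoint_spectra {..<n} (bloch_matrix A g v e) (bloch_matrix A h v e)"
proof -
  obtain U e and d :: "int ^ 'd" where U: "U \<noteq> {}" "U \<subseteq> {..<n}" "symmetric_weights e" and d: "d \<noteq> 0"
    and disj: "\<And>g h. multiplicative_character g \<Longrightarrow> multiplicative_character h \<Longrightarrow> g d = 1 \<Longrightarrow> h d \<noteq> 1 \<Longrightarrow>
      disjoint_spectra U (bloch_matrix A g (\<lambda>_. 0) e) (bloch_matrix A h (\<lambda>_. 0) e)"
    by (rule cycle_weights) blast
  obtain r where r: "d $ r \<noteq> 0" using d by (auto simp: Finite_Cartesian_Product.vec_eq_iff)
  \<comment> \<open>\<open>g\<close> is the point with all coordinates 1, and \<open>h\<close> the
    point with coordinate 2 at \<open>r\<close> and 1 elsewhere; \<open>r\<close> is chosen with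
    \<open>d $ r\<close> nonzero, so that \<open>h d\<close> is a nontrivial power of 2.\<close>
  define g :: "int ^ 'd \<Rightarrow> complex" where "g = (\<lambda>_. 1)"
  define h :: "int ^ 'd \<Rightarrow> complex" where "h = (\<lambda>c. 2 powi (c $ r))"
  have g: "multiplicative_character g" by (simp add: g_def multiplicative_character_def)
  have h: "multiplicative_character h"
    by (simp add: h_def multiplicative_character_def power_int_add)
  have "norm (h d) = 2 powr (d $ r)"
    by (simp add: h_def norm_power_int powr_real_of_int')
  then have "h d \<noteq> 1" using r by auto
  then have "disjoint_spectra U (bloch_matrix A g (\<lambda>_. 0) e) (bloch_matrix A h (\<lambda>_. 0) e)"
    using g h by (intro disj) (simp_all add: g_def)
  then show ?thesis
    using disjoint_spectra_extend[OF g h U] that g h by blast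
qed

end

section \<open>Evaluation of the dispersion polynomial\<close>

definition eval_laurent :: "('g::ab_group_add \<Rightarrow> complex) \<Rightarrow> ('g \<Rightarrow>\<^sub>0 complex) \<Rightarrow> complex" where
  "eval_laurent h f = (\<Sum>a\<in>Poly_Mapping.keys f. Poly_Mapping.lookup f a * h a)"

lemma eval_laurent_superset:
  assumes "finite S" "Poly_Mapping.keys f \<subseteq> S"
  shows "eval_laurent h f = (\<Sum>a\<in>S. Poly_Mapping.lookup f a * h a)"
  unfolding eval_laurent_def
  using assms by (intro sum.mono_neutral_left) (auto simp: in_keys_iff)

lemma eval_laurent_single [simp]: "eval_laurent h (Poly_Mapping.single a c) = c * h a"
  by (subst eval_laurent_superset[of "{a}"]) auto

lemma eval_laurent_zero [simp]: "eval_laurent h 0 = 0"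
  by (simp add: eval_laurent_def)

lemma eval_laurent_add: "eval_laurent h (f + g) = eval_laurent h f + eval_laurent h g"
proof -
  let ?S = "Poly_Mapping.keys f \<union> Poly_Mapping.keys g"
  have "Poly_Mapping.keys (f + g) \<subseteq> ?S" by (rule Poly_Mapping.keys_add)
  then show ?thesis
    by (simp add: eval_laurent_superset[of ?S] lookup_add distrib_right sum.distrib)
qed

lemma eval_laurent_sum: "eval_laurent h (\<Sum>i\<in>I. f i) = (\<Sum>i\<in>I. eval_laurent h (f i))"
  by (induction I rule: infinite_finite_induct) (simp_all add: eval_laurent_add)

lemma laurent_eq_sum_monomials:
  "f = (\<Sum>a\<in>Poly_Mapping.keys f. Poly_Mapping.single a (Poly_Mapping.lookup f a))"
  by (rule poly_mapping_eqI)
    (auto simp: lookup_sum lookup_single when_def in_keys_iff sum.delta)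

lemma eval_laurent_mult:
  assumes h: "multiplicative_character h"
  shows "eval_laurent h (f * g) = eval_laurent h f * eval_laurent h g"
proof -
  let ?l = Poly_Mapping.lookup and ?s = Poly_Mapping.single
  have "f * g = (\<Sum>a\<in>Poly_Mapping.keys f. ?s a (?l f a)) * (\<Sum>b\<in>Poly_Mapping.keys g. ?s b (?l g b))"
    using laurent_eq_sum_monomials[of f] laurent_eq_sum_monomials[of g] by simp
  also have "\<dots> = (\<Sum>a\<in>Poly_Mapping.keys f. \<Sum>b\<in>Poly_Mapping.keys g. ?s (a + b) (?l f a * ?l g b))"
    by (simp add: sum_product mult_single)
  also have "eval_laurent h \<dots> =
      (\<Sum>a\<in>Poly_Mapping.keys f. \<Sum>b\<in>Poly_Mapping.keys g. (?l f a * h a) * (?l g b * h b))"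
    by (simp add: eval_laurent_sum multiplicative_characterD(2)[OF h] ac_simps)
  also have "\<dots> = eval_laurent h f * eval_laurent h g"
    by (simp add: eval_laurent_def sum_product)
  finally show ?thesis .
qed

lemma eval_laurent_one: "multiplicative_character h \<Longrightarrow> eval_laurent h 1 = 1"
  using eval_laurent_single[of h 0 1] by (simp add: multiplicative_characterD(1))

abbreviation quotient_arcs ::
    "'v pair_pre_digraph \<Rightarrow> ('v \<Rightarrow> int ^ 'd \<Rightarrow> 'v) \<Rightarrow> (nat \<Rightarrow> 'v) \<Rightarrow> nat \<Rightarrow> nat \<Rightarrow> (int ^ 'd) set" where
  "quotient_arcs G shift w i j \<equiv> {a. (w i, shift (w j) a) \<in> parcs G}"

definition labeling_bloch_matrix ::
    "'v pair_pre_digraph \<Rightarrow> ('v \<Rightarrow> int ^ 'd \<Rightarrow> 'v) \<Rightarrow> (nat \<Rightarrow> 'v) \<Rightarrow> (int ^ 'd \<Rightarrow> complex) \<Rightarrow>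
     'v labeling \<Rightarrow> nat \<Rightarrow> nat \<Rightarrow> complex" where
  "labeling_bloch_matrix G shift w h x = bloch_matrix (quotient_arcs G shift w) h
     (\<lambda>i. fst x (w i)) (\<lambda>i j a. snd x (w i, shift (w j) a))"

lemma eval_floquet_matrix:
  fixes shift :: "'v \<Rightarrow> int ^ 'd::finite \<Rightarrow> 'v"
  assumes h: "multiplicative_character h" and ij: "i < n" "j < n"
  shows "eval_laurent h (floquet_matrix G shift n w x $$ (i, j)) = labeling_bloch_matrix G shift w h x i j"
proof (cases x)
  case (Pair V E)
  then show ?thesis
    using ij multiplicative_characterD(1)[OF h]
    by (simp add: floquet_matrix_def labeling_bloch_matrix_def bloch_matrix_def
        eval_laurent_add eval_laurent_sum laurent_const_def)
qed

abbreviation labeling_char_poly ::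
    "'v pair_pre_digraph \<Rightarrow> ('v \<Rightarrow> int ^ 'd \<Rightarrow> 'v) \<Rightarrow> nat \<Rightarrow> (nat \<Rightarrow> 'v) \<Rightarrow> (int ^ 'd \<Rightarrow> complex) \<Rightarrow>
     'v labeling \<Rightarrow> complex poly" where
  "labeling_char_poly G shift n w h x \<equiv>
     char_poly (mat n n (\<lambda>(i, j). labeling_bloch_matrix G shift w h x i j))"

text \<open>Substituting \<open>c\<close> for the variable and then evaluating at \<open>h\<close>
  is a ring homomorphism. It commutes with the determinant and kills the factor
  \<open>\<lambda> - c\<close>, so \<open>c\<close> is an eigenvalue of the Floquet matrix at
  \<open>h\<close>.\<close>

lemma flat_band_root:
  fixes shift :: "'v \<Rightarrow> int ^ 'd::finite \<Rightarrow> 'v"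
  assumes h: "multiplicative_character h"
    and dvd: "[:- laurent_const c, 1:] dvd dispersion_poly G shift n w x"
  shows "poly (labeling_char_poly G shift n w h x) c = 0"
proof -
  define ev where "ev = (\<lambda>p. eval_laurent h (poly p (laurent_const c :: 'd laurent)))"
  interpret ev: comm_ring_hom ev
    by unfold_locales
      (simp_all add: ev_def eval_laurent_add eval_laurent_mult[OF h] eval_laurent_one[OF h])
  let ?F = "floquet_matrix G shift n w x"
  let ?B = "mat n n (\<lambda>(i, j). labeling_bloch_matrix G shift w h x i j)"
  have B: "?B \<in> carrier_mat n n" by simp
  have F: "?F \<in> carrier_mat n n" by (cases x) (simp add: floquet_matrix_def)
  from dvd obtain q where "dispersion_poly G shift n w x = [:- laurent_const c, 1:] * q"
    by (rule dvdE)
  then have "ev (dispersion_poly G shift n w x) = 0" by (simp add: ev_def)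
  also have "ev (dispersion_poly G shift n w x) =
      det (map_mat ev (map_mat (\<lambda>f. [:f:]) ?F - [:0, 1:] \<cdot>\<^sub>m 1\<^sub>m n))"
    by (simp add: dispersion_poly_def)
  also have "map_mat ev (map_mat (\<lambda>f. [:f:]) ?F - [:0, 1:] \<cdot>\<^sub>m 1\<^sub>m n) = char_matrix ?B c"
  proof (rule eq_matI)
    fix i j assume "i < dim_row (char_matrix ?B c)" "j < dim_col (char_matrix ?B c)"
    then have ij: "i < n" "j < n" by (simp_all add: char_matrix_def)
    have "ev ([:?F $$ (i, j):] - (if i = j then [:0, 1:] else 0)) =
        labeling_bloch_matrix G shift w h x i j - (if i = j then c else 0)"
      using ij multiplicative_characterD(1)[OF h]
      by (simp add: ev.hom_minus) (simp add: ev_def eval_floquet_matrix[OF h] laurent_const_def)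
    then show "map_mat ev (map_mat (\<lambda>f. [:f:]) ?F - [:0, 1:] \<cdot>\<^sub>m 1\<^sub>m n) $$ (i, j) = char_matrix ?B c $$ (i, j)"
      using ij F by (auto simp: char_matrix_def split: if_splits)
  qed (use F in \<open>simp_all add: char_matrix_def\<close>)
  finally have "eigenvalue ?B c" by (simp add: eigenvalue_det[OF B])
  then show ?thesis by (simp add: eigenvalue_root_char_poly[OF B])
qed

section \<open>Polynomial dependence on the labeling, and resultants\<close>

lemma labeling_polynomial_sum:
  "(\<And>i. i \<in> I \<Longrightarrow> labeling_polynomial G shift n w (f i)) \<Longrightarrow>
    labeling_polynomial G shift n w (\<lambda>x. \<Sum>i\<in>I. f i x)"
  by (induction I rule: infinite_finite_induct)
    (auto intro: labeling_polynomial.const labeling_polynomial.add)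

lemma labeling_polynomial_prod:
  "(\<And>i. i \<in> I \<Longrightarrow> labeling_polynomial G shift n w (f i)) \<Longrightarrow>
    labeling_polynomial G shift n w (\<lambda>x. \<Prod>i\<in>I. f i x)"
  by (induction I rule: infinite_finite_induct)
    (auto intro: labeling_polynomial.const labeling_polynomial.mult)

lemma labeling_polynomial_if:
  "(P \<Longrightarrow> labeling_polynomial G shift n w p) \<Longrightarrow> (\<not> P \<Longrightarrow> labeling_polynomial G shift n w q) \<Longrightarrow>
    labeling_polynomial G shift n w (\<lambda>x. if P then p x else q x)"
  by (cases P) auto

definition poly_over_labelings ::
    "'v pair_pre_digraph \<Rightarrow> ('v \<Rightarrow> int ^ 'd \<Rightarrow> 'v) \<Rightarrow> nat \<Rightarrow> (nat \<Rightarrow> 'v) \<Rightarrow>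
     ('v labeling \<Rightarrow> complex poly) \<Rightarrow> bool" where
  "poly_over_labelings G shift n w p \<longleftrightarrow> (\<forall>k. labeling_polynomial G shift n w (\<lambda>x. coeff (p x) k))"

lemma poly_over_labelings_const: "poly_over_labelings G shift n w (\<lambda>_. p)"
  by (simp add: poly_over_labelings_def labeling_polynomial.const)

lemma poly_over_labelings_mult:
  "poly_over_labelings G shift n w p \<Longrightarrow> poly_over_labelings G shift n w q \<Longrightarrow>
    poly_over_labelings G shift n w (\<lambda>x. p x * q x)"
  unfolding poly_over_labelings_def coeff_mult
  by (intro allI labeling_polynomial_sum labeling_polynomial.mult) auto

lemma poly_over_labelings_sum:
  "(\<And>i. i \<in> I \<Longrightarrow> poly_over_labelings G shift n w (f i)) \<Longrightarrow>
    poly_over_labelings G shift n w (\<lambda>x. \<Sum>i\<in>I. f i x)"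
  unfolding poly_over_labelings_def coeff_sum by (intro allI labeling_polynomial_sum) auto

lemma poly_over_labelings_prod:
  "(\<And>i. i \<in> I \<Longrightarrow> poly_over_labelings G shift n w (f i)) \<Longrightarrow>
    poly_over_labelings G shift n w (\<lambda>x. \<Prod>i\<in>I. f i x)"
  by (induction I rule: infinite_finite_induct)
    (auto intro: poly_over_labelings_const poly_over_labelings_mult)

lemma permutes_lessThan: "p \<in> {p. p permutes {0..<m}} \<Longrightarrow> i \<in> {0..<m} \<Longrightarrow> p i < m"
  using permutes_in_image[of p "{0..<m}" i] by simp

text \<open>The Leibniz formula writes the characteristic polynomial as a sum of products of
  entries, each of degree at most 1 with coefficients polynomial in the labeling.\<close>

lemma poly_over_labelings_char_poly:
  assumes "\<And>i j. i < m \<Longrightarrow> j < m \<Longrightarrow> labeling_polynomial G shift n w (\<lambda>x. B x i j)"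
  shows "poly_over_labelings G shift n w (\<lambda>x. char_poly (mat m m (\<lambda>(i, j). B x i j)))"
proof -
  have entry: "poly_over_labelings G shift n w
      (\<lambda>x. char_poly_matrix (mat m m (\<lambda>(i, j). B x i j)) $$ (i, j))"
    if ij: "i < m" "j < m" for i j
    unfolding poly_over_labelings_def
  proof
    fix k
    have "(\<lambda>x. coeff (char_poly_matrix (mat m m (\<lambda>(i, j). B x i j)) $$ (i, j)) k) =
      (\<lambda>x. (if i = j \<and> k = 1 then 1 else 0) + (if k = 0 then -1 else 0) * B x i j)"
      using ij by (auto simp: char_poly_matrix_def coeff_pCons fun_eq_iff split: nat.split)
    then show "labeling_polynomial G shift n w
        (\<lambda>x. coeff (char_poly_matrix (mat m m (\<lambda>(i, j). B x i j)) $$ (i, j)) k)"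
      using assms[OF ij]
      by (simp only:) (intro labeling_polynomial.intros)
  qed
  have C: "char_poly_matrix (mat m m (\<lambda>(i, j). B x i j)) \<in> carrier_mat m m" for x by simp
  show ?thesis
    unfolding char_poly_def det_def'[OF C]
    by (intro poly_over_labelings_sum poly_over_labelings_mult poly_over_labelings_prod
        poly_over_labelings_const entry) (simp_all add: permutes_lessThan)
qed

lemma labeling_polynomial_bloch_matrix:
  assumes "i < n" "j < n"
  shows "labeling_polynomial G shift n w (\<lambda>x. labeling_bloch_matrix G shift w h x i j)"
proof -
  have "labeling_polynomial G shift n w (\<lambda>x. fst x (w i))"
  proof -
    have "labeling_polynomial G shift n w (\<lambda>(V, E). V (w i))"
      using assms(1) by (rule labeling_polynomial.vertex_coord)
    then show ?thesis by (simp add: case_prod_unfold)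
  qed
  moreover have "labeling_polynomial G shift n w (\<lambda>x. snd x (w i, shift (w j) a))"
    if "(w i, shift (w j) a) \<in> parcs G" for a
  proof -
    have "labeling_polynomial G shift n w (\<lambda>(V, E). E (w i, shift (w j) a))"
      using assms that by (rule labeling_polynomial.edge_coord)
    then show ?thesis by (simp add: case_prod_unfold)
  qed
  ultimately show ?thesis
    unfolding labeling_bloch_matrix_def bloch_matrix_def
    by (cases "i = j")
      (auto intro!: labeling_polynomial_sum labeling_polynomial.add labeling_polynomial.mult
        intro: labeling_polynomial.const)
qed

text \<open>Both characteristic polynomials have degree \<open>n\<close> for every labeling, so the
  Sylvester matrix has the fixed size \<open>n + n\<close> and the Leibniz formula applies
  uniformly.\<close>

lemma labeling_polynomial_resultant:
  "labeling_polynomial G shift n w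
    (\<lambda>x. resultant (labeling_char_poly G shift n w g x) (labeling_char_poly G shift n w h x))"
proof -
  let ?p = "\<lambda>h x. labeling_char_poly G shift n w h x"
  have deg: "degree (?p h x) = n" for h x
    using degree_monic_char_poly[of "mat n n (\<lambda>(i, j). labeling_bloch_matrix G shift w h x i j)" n]
    by simp
  have coeffs: "labeling_polynomial G shift n w (\<lambda>x. coeff (?p h x) k)" for h k
    using poly_over_labelings_char_poly[of n G shift n w "labeling_bloch_matrix G shift w h"]
      labeling_polynomial_bloch_matrix unfolding poly_over_labelings_def by blast
  have entry: "labeling_polynomial G shift n w (\<lambda>x. sylvester_mat_sub n n (?p g x) (?p h x) $$ (i, j))"
    if "i < n + n" "j < n + n" for i j
    unfolding sylvester_mat_sub_index[OF that]
    by (intro labeling_polynomial_if coeffs labeling_polynomial.const)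
  show ?thesis
    unfolding resultant_def sylvester_mat_def deg det_def'[OF sylvester_mat_sub_carrier]
    by (intro labeling_polynomial_sum labeling_polynomial.mult labeling_polynomial_prod
        labeling_polynomial.const entry) (simp_all add: permutes_lessThan)
qed

text \<open>The resultant vanishes iff the gcd is nonconstant, which over the complex numbers means
  that the gcd has a root.\<close>

lemma complex_resultant_eq_0_iff:
  fixes p q :: "complex poly"
  assumes "p \<noteq> 0"
  shows "resultant p q = 0 \<longleftrightarrow> (\<exists>c. poly p c = 0 \<and> poly q c = 0)"
proof -
  have "degree r \<noteq> 0 \<longleftrightarrow> (\<exists>c. poly r c = 0)" if "r \<noteq> 0" for r :: "complex poly"
  proof
    assume "degree r \<noteq> 0"
    then show "\<exists>c. poly r c = 0"
      by (intro fundamental_theorem_of_algebra) (simp add: constant_degree)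
  next
    assume "\<exists>c. poly r c = 0"
    then show "degree r \<noteq> 0" using that by (auto elim!: degree_eq_zeroE)
  qed
  then have "degree (gcd p q) \<noteq> 0 \<longleftrightarrow> (\<exists>c. poly (gcd p q) c = 0)" using assms by simp
  then show ?thesis
    unfolding resultant_0_gcd poly_eq_0_iff_dvd by simp
qed

section \<open>Labelings from weights of the quotient graph\<close>

context periodic_graph
begin

section \<open>Orbit coordinates and the quotient of a periodic graph\<close>

lemma shift_minus:
  assumes "u \<in> pverts G"
  shows "shift (shift u a) (- a) = u"
  using shift_add[OF assms, of a "- a"] shift_zero[OF assms] by simp

text \<open>Every vertex is \<open>w i + a\<close> for exactly one pair: \<open>i\<close> is unique
  because \<open>W\<close> meets each orbit once, \<open>a\<close> because the action is
  free.\<close>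

lemma orbit_coordinates:
  assumes fd: "fundamental_domain G shift W" and w: "bij_betw w {..<card W} W"
  obtains idx pos where
    "\<And>x. x \<in> pverts G \<Longrightarrow> idx x < card W \<and> shift (w (idx x)) (pos x) = x"
    "\<And>i a. i < card W \<Longrightarrow> idx (shift (w i) a) = i \<and> pos (shift (w i) a) = a"
proof -
  have wV: "w i \<in> pverts G" "w i \<in> W" if "i < card W" for i
    using that fd w by (auto simp: fundamental_domain_def bij_betw_def)
  have ex: "\<exists>i a. i < card W \<and> shift (w i) a = x" if x: "x \<in> pverts G" for x
  proof -
    from fd x obtain y b where y: "y \<in> W" "y = shift x b"
      unfolding fundamental_domain_def by blast
    then obtain i where i: "i < card W" "y = w i" using w by (auto simp: bij_betw_def)
    have "shift (w i) (- b) = x" using shift_minus[OF x, of b] y i by simp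
    then show ?thesis using i by blast
  qed
  define idx where "idx x = (SOME i. i < card W \<and> (\<exists>a. shift (w i) a = x))" for x
  define pos where "pos x = (SOME a. shift (w (idx x)) a = x)" for x
  have coord: "idx x < card W \<and> shift (w (idx x)) (pos x) = x" if x: "x \<in> pverts G" for x
  proof -
    have "idx x < card W \<and> (\<exists>a. shift (w (idx x)) a = x)"
      unfolding idx_def using ex[OF x] by (rule someI_ex[OF ex_forward]) blast
    then show ?thesis unfolding pos_def by (metis (mono_tags, lifting) someI_ex)
  qed
  have unique: "i = j \<and> a = b" if ij: "i < card W" "j < card W" and eq: "shift (w i) a = shift (w j) b" for i j a b
  proof -
    let ?x = "shift (w i) a"
    have x: "?x \<in> pverts G" by (rule shift_in_verts[OF wV(1)[OF ij(1)]])
    have "w i \<in> range (shift ?x)" "w j \<in> range (shift ?x)"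
      using shift_minus[OF wV(1)[OF ij(1)], of a] shift_minus[OF wV(1)[OF ij(2)], of b] eq by (metis rangeI)+
    then have "w i = w j" using fd x wV(2) ij unfolding fundamental_domain_def by blast
    then have i: "i = j" using w ij by (auto simp: bij_betw_def inj_on_def)
    have "shift (w i) (a - b) = shift (shift (w i) a) (- b)"
      using shift_add[OF wV(1)[OF ij(1)], of a "- b"] by simp
    also have "\<dots> = w i" using shift_minus[OF wV(1)[OF ij(1)], of b] eq i by simp
    finally have "a - b = 0" by (rule shift_free[OF wV(1)[OF ij(1)]])
    with i show ?thesis by simp
  qed
  show ?thesis
  proof (rule that[OF coord])
    fix i a assume i: "i < card W"
    then have "shift (w i) a \<in> pverts G" by (intro shift_in_verts wV)
    from coord[OF this] unique i show "idx (shift (w i) a) = i \<and> pos (shift (w i) a) = a" by blast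
  qed
qed

lemma parcs_sym: "(u, v) \<in> parcs G \<Longrightarrow> (v, u) \<in> parcs G"
  using pair_sym_arcs by (auto simp: symmetric_def dest: symD)

text \<open>Connectedness of a digraph means strong connectedness of its symmetric closure, and here
  the arcs are already symmetric.\<close>

lemma connected_rtrancl:
  assumes "Digraph_Component.connected (with_proj G)" "u \<in> pverts G" "v \<in> pverts G"
  shows "(u, v) \<in> (parcs G)\<^sup>*"
proof -
  have "u \<rightarrow>\<^sup>*\<^bsub>with_proj (mk_symmetric (with_proj G))\<^esub> v"
    using assms by (auto simp: connected_def strongly_connected_def)
  then have "(u, v) \<in> (parcs (mk_symmetric (with_proj G)))\<^sup>*"
    unfolding reachable_def by (auto dest: rtrancl_on_rtranclI)
  also have "parcs (mk_symmetric (with_proj G)) \<subseteq> parcs G"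
    using parcs_sym by (auto simp: parcs_mk_symmetric)
  finally (rtrancl_mono[THEN subsetD, rotated]) show ?thesis .
qed

lemma quotient_graph_arcs:
  assumes conn: "Digraph_Component.connected (with_proj G)"
    and fd: "fundamental_domain G shift W" and w: "bij_betw w {..<card W} W"
  shows "quotient_graph (card W) (quotient_arcs G shift w)"
proof -
  have wV: "w i \<in> pverts G" if "i < card W" for i
    using that fd w by (auto simp: fundamental_domain_def bij_betw_def)
  obtain idx pos where coord: "\<And>x. x \<in> pverts G \<Longrightarrow> idx x < card W \<and> shift (w (idx x)) (pos x) = x"
    and coord': "\<And>i a. i < card W \<Longrightarrow> idx (shift (w i) a) = i \<and> pos (shift (w i) a) = a"
    using orbit_coordinates[OF fd w] by metis
  show ?thesis
  proof
    show "0 < card W" using nonempty coord by fastforce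
    show "finite (quotient_arcs G shift w i j)" if "j < card W" for i j
      by (rule finite_floquet_support[OF wV[OF that]])
    show "- c \<in> quotient_arcs G shift w j i"
      if ij: "i < card W" "j < card W" and c: "c \<in> quotient_arcs G shift w i j" for i j c
      using parcs_sym[of "w i" "shift (w j) c"] c shift_arcs[of "shift (w j) c" "w i" "- c"]
        shift_minus[OF wV[OF ij(2)]] by simp
    fix i j :: nat and a b :: "int ^ 'd"
    assume ij: "i < card W" "j < card W"
    define R where "R = {((i, a), (j, b)). i < card W \<and> j < card W \<and> b - a \<in> quotient_arcs G shift w i j}"
    \<comment> \<open>Translating an arc by \<open>- pos x\<close> moves its start to the
      representative \<open>w (idx x)\<close>, so walks of the graph become walks in
      coordinates.\<close>
    have arc: "((idx x, pos x), (idx y, pos y)) \<in> R" if xy: "(x, y) \<in> parcs G" for x y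
    proof -
      have x: "x \<in> pverts G" and y: "y \<in> pverts G" using xy by (auto dest: in_arcsD1 in_arcsD2)
      have "shift x (- pos x) = w (idx x)"
        using shift_minus[OF wV, of "idx x" "pos x"] coord[OF x] by simp
      moreover have "shift y (- pos x) = shift (w (idx y)) (pos y - pos x)"
        using shift_add[OF wV, of "idx y" "pos y" "- pos x"] coord[OF y] by simp
      ultimately have "(w (idx x), shift (w (idx y)) (pos y - pos x)) \<in> parcs G"
        using shift_arcs[OF xy, of "- pos x"] by simp
      then show ?thesis using coord[OF x] coord[OF y] by (simp add: R_def)
    qed
    have "(shift (w i) a, shift (w j) b) \<in> (parcs G)\<^sup>*"
      using conn shift_in_verts[OF wV] ij by (intro connected_rtrancl)
    then have "((idx (shift (w i) a), pos (shift (w i) a)), (idx (shift (w j) b), pos (shift (w j) b))) \<in> R\<^sup>*"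
      by (induction rule: rtrancl_induct) (auto intro: rtrancl_into_rtrancl[OF _ arc])
    then show "((i, a), (j, b)) \<in> {((i, a), (j, b)). i < card W \<and> j < card W \<and>
        b - a \<in> quotient_arcs G shift w i j}\<^sup>*"
      unfolding R_def[symmetric] using coord'[OF ij(1), of a] coord'[OF ij(2), of b] by simp
  qed
qed

text \<open>Weights of the quotient are spread over the orbits; the edge label depends only on the
  two indices and the difference of positions, hence is invariant under translation.\<close>

lemma labeling_of_weights:
  assumes fd: "fundamental_domain G shift W" and w: "bij_betw w {..<card W} W"
    and e: "symmetric_weights e"
  obtains x where "x \<in> labelings G shift"
    "\<And>h i j. i < card W \<Longrightarrow> j < card W \<Longrightarrow>
      labeling_bloch_matrix G shift w h x i j = bloch_matrix (quotient_arcs G shift w) h v e i j"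
proof -
  have wV: "w i \<in> pverts G" if "i < card W" for i
    using that fd w by (auto simp: fundamental_domain_def bij_betw_def)
  obtain idx pos where coord: "\<And>x. x \<in> pverts G \<Longrightarrow> idx x < card W \<and> shift (w (idx x)) (pos x) = x"
    and coord': "\<And>i a. i < card W \<Longrightarrow> idx (shift (w i) a) = i \<and> pos (shift (w i) a) = a"
    using orbit_coordinates[OF fd w] by metis
  have coord_w: "idx (w i) = i \<and> pos (w i) = 0" if "i < card W" for i
    using coord'[OF that, of 0] shift_zero[OF wV[OF that]] by simp
  have shift_coord: "idx (shift x a) = idx x \<and> pos (shift x a) = pos x + a" if "x \<in> pverts G" for x a
    using coord[OF that] coord'[of "idx x" "pos x + a"] shift_add[OF wV, of "idx x" "pos x" a] by simp
  define V where "V x = (if x \<in> pverts G then v (idx x) else 0)" for x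
  define E where "E xy = (if xy \<in> parcs G then
    e (idx (fst xy)) (idx (snd xy)) (pos (snd xy) - pos (fst xy)) else 0)" for xy
  have e': "e i j c = e j i c'" if "c' = - c" for i j c c'
    using e that by (simp add: symmetric_weights_def)
  show ?thesis
  proof (rule that[of "(V, E)"])
    have "V (shift u a) = V u" if "u \<in> pverts G" for u a
      using that shift_in_verts shift_coord by (simp add: V_def)
    moreover have "E (y, z) = E (z, y)" if "(y, z) \<in> parcs G" for y z
      using that parcs_sym[OF that] by (auto simp: E_def intro: e')
    moreover have "E (shift y a, shift z a) = E (y, z)" if "(y, z) \<in> parcs G" for y z a
      using that shift_arcs[OF that] shift_coord[OF in_arcsD1[OF that]] shift_coord[OF in_arcsD2[OF that]]
      by (simp add: E_def)
    moreover have "V u = 0" if "u \<notin> pverts G" for u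
      using that by (simp add: V_def)
    moreover have "E xy = 0" if "xy \<notin> parcs G" for xy
      using that by (simp add: E_def)
    ultimately show "(V, E) \<in> labelings G shift"
      unfolding labelings_def by blast
    show "labeling_bloch_matrix G shift w h (V, E) i j = bloch_matrix (quotient_arcs G shift w) h v e i j"
      if ij: "i < card W" "j < card W" for h i j
      unfolding labeling_bloch_matrix_def bloch_matrix_def
      using ij wV coord_w coord' by (auto simp: V_def E_def intro!: sum.cong)
  qed
qed

end

section \<open>The exceptional set of labelings\<close>

theorem theorem1p1:
  fixes G :: "'v pair_pre_digraph"
    and shift :: "'v \<Rightarrow> int ^ 'd::finite \<Rightarrow> 'v"
    and W :: "'v set" and w :: "nat \<Rightarrow> 'v"
  assumes "periodic_graph G shift"
    and "Digraph_Component.connected (with_proj G)"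
    and "fundamental_domain G shift W"
    and "bij_betw w {..<card W} W"
  shows "\<exists>S. algebraic_subset G shift (card W) w S \<and> S \<subset> labelings G shift \<and>
    (\<forall>x \<in> labelings G shift - S.
      \<not> (\<exists>c :: complex.
        [:- laurent_const c, 1:] dvd dispersion_poly G shift (card W) w x))"
proof -
  interpret periodic_graph G shift by (rule assms(1))
  interpret Q: quotient_graph "card W" "quotient_arcs G shift w"
    by (rule quotient_graph_arcs[OF assms(2-4)])
  let ?n = "card W"
  let ?p = "labeling_char_poly G shift ?n w"
  obtain g h :: "int ^ 'd \<Rightarrow> complex" and v e
    where g: "multiplicative_character g" and h: "multiplicative_character h" and e: "symmetric_weights e"
      and disj: "disjoint_spectra {..<?n} (bloch_matrix (quotient_arcs G shift w) g v e)
        (bloch_matrix (quotient_arcs G shift w) h v e)"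
    by (rule Q.ex_disjoint_spectra)
  \<comment> \<open>\<open>S\<close> is the zero set of one polynomial: the labelings whose Floquet
    matrices at \<open>g\<close> and \<open>h\<close> share an eigenvalue.\<close>
  define S where "S = {x \<in> labelings G shift. resultant (?p g x) (?p h x) = 0}"
  have "algebraic_subset G shift ?n w S"
    unfolding algebraic_subset_def S_def
    by (intro exI[of _ "{\<lambda>x. resultant (?p g x) (?p h x)}"])
      (auto intro: labeling_polynomial_resultant)
  moreover have nz: "?p g x \<noteq> 0" for x
    using degree_monic_char_poly[of "mat ?n ?n (\<lambda>(i, j). labeling_bloch_matrix G shift w g x i j)" ?n] by auto
  \<comment> \<open>A labeling realising the weights with disjoint spectra; it lies outside
    \<open>S\<close> and makes \<open>S\<close> proper.\<close>
  obtain x where x: "x \<in> labelings G shift" and bloch: "\<And>h i j. i < ?n \<Longrightarrow> j < ?n \<Longrightarrow>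
      labeling_bloch_matrix G shift w h x i j = bloch_matrix (quotient_arcs G shift w) h v e i j"
    using labeling_of_weights[OF assms(3,4) e] by blast
  have "poly (?p h x) c = 0 \<longleftrightarrow>
      eigenvalue_on {..<?n} (bloch_matrix (quotient_arcs G shift w) h v e) c" for h c
  proof -
    have "bij_betw id {..<?n} {..<?n}" by simp
    note eigenvalue_on_iff_char_poly[OF this, of "bloch_matrix (quotient_arcs G shift w) h v e" c]
    moreover have "mat ?n ?n (\<lambda>(i, j). labeling_bloch_matrix G shift w h x i j) =
        mat ?n ?n (\<lambda>(i, j). bloch_matrix (quotient_arcs G shift w) h v e (id i) (id j))"
      by (rule eq_matI) (auto simp: bloch)
    ultimately show ?thesis by simp
  qed
  then have "resultant (?p g x) (?p h x) \<noteq> 0"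
    using disj by (simp add: complex_resultant_eq_0_iff[OF nz] disjoint_spectra_def)
  then have "S \<subset> labelings G shift" using x by (auto simp: S_def)
  \<comment> \<open>A flat band at \<open>c\<close> makes \<open>c\<close> a common root of the two
    characteristic polynomials.\<close>
  moreover have "resultant (?p g x) (?p h x) = 0"
    if "[:- laurent_const c, 1:] dvd dispersion_poly G shift ?n w x" for x c
    using flat_band_root[OF g that] flat_band_root[OF h that]
    by (auto simp: complex_resultant_eq_0_iff[OF nz])
  then have "\<forall>x \<in> labelings G shift - S.
      \<not> (\<exists>c. [:- laurent_const c, 1:] dvd dispersion_poly G shift ?n w x)"
    unfolding S_def by blast
  ultimately show ?thesis by blast
qed

end
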